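(* The functor $\Xi_{\Delta}\colon t\Delta_+\to i\Delta_+$ is an equivalence of categories, and it is surjective on objects.
   Context: Ordinals. For $n\ge-1$ let $[n]=\{0,\dots,n\}$ with its usual order ($[-1]=\emptyset$); $\Delta_+$ is the category of all $[n]$, $n\ge-1$, and order-preserving maps. Let $[m]^\wedge=[m+1]$, and for $g\colon[m]\to[n]$ let $g^\wedge\colon[n+1]\to[m+1]$, $g^\wedge(j)=\min(\{i\in[m] : j\le g(i)\}\cup\{m+1\})$; it is order-preserving and preserves the least and greatest elements. The endpoints of $[n]$ ($n\ge0$) are its least and greatest elements. The category $i\Delta_+$, defined inductively. The object of height $0$ is the ordinal $[-1]$; it is called trivial, and it is the only object whose underlying ordinal is $[-1]$. For $n\ge1$, an object $K$ of height $n$ consists of an ordinal $\mathrm{Ob}\,K$ and, for each $j\in(\mathrm{Ob}\,K)^\wedge$, an object $K(j)$ of height strictly less than $n$, such that $K(j)$ is trivial if and only if $j$ is an endpoint of $(\mathrm{Ob}\,K)^\wedge$. For every object $K$ there is a unique morphism $[-1]\to K$. For $H$ nontrivial, a morphism $g\colon H\to K$ consists of an order-preserving map $g\colon\mathrm{Ob}\,H\to\mathrm{Ob}\,K$ and, for every $j\in(\mathrm{Ob}\,K)^\wedge$, a morphism $g(j)\colon H(g^\wedge j)\to K(j)$ (so there is none if $K$ is trivial). Composition: the object map is the composite and $(g\circ f)(j)=g(j)\circ f(g^\wedge j)$. Trees. A tree $(A,p)$ is a sequence of sets $A_n$ ($n\ge0$) and maps $p_n\colon A_{n+1}\to A_n$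 with $A_0$ a singleton $\{\ast\}$; a tree map $f\colon(A,p)\to(B,q)$ is a sequence of maps $f_n\colon A_n\to B_n$ with $q_nf_{n+1}=f_np_n$. The tree has degree $n$ if every composite $A_{n+m}\to A_n$ ($m\ge1$) of the maps $p$ is bijective, and finite degree if it has degree $n$ for some $n\in\mathbb{N}$. The category $t\Delta_+$. An object is a tree $(A,p)$ of finite degree with an ordinal $F_n(y)\in\Delta_+$ for each $y\in A_n$, $n\ge0$, and bijections $\lambda_n\colon A_{n+1}\cong\{(y,\xi) : y\in A_n,\ \xi\in F_n(y)^\wedge\}$ of the form $\lambda_n(x)=(p_n(x),\lambda_{n,x})$, which is cropped: for all $n$ and $x\in A_{n+1}$, $\lambda_{n,x}$ is the least or greatest element of $F_n(p_nx)^\wedge$ if and only if $F_{n+1}(x)^\wedge$ is a singleton (i.e. $F_{n+1}(x)=[-1]$). Objects of degree $0$ (equivalently $F_0(\ast)=[-1]$) are called trivial. A morphism $(f,\alpha)\colon(B,q,G,\eta)\to(A,p,F,\lambda)$ is a tree map $f\colon A\to B$ together with order-preserving maps $\alpha_{n,x}\colon G_n(f_nx)\to F_n(x)$ for all $n$ and $x\in A_n$, such that $\eta_{n,f_{n+1}x}=(\alpha_{n,p_nx})^\wedge(\lambda_{n,x})$ for all $x\in A_{n+1}$. The composite of $(g,\beta)\colon(C,H)\to(B,G)$ and then $(f,\alpha)\colon(B,G)\to(A,F)$ has tree map $g\circ f\colon A\to C$ and components $\alpha_{n,x}\circ\beta_{n,f_nx}$. For $x\in A_1$, the restriction $A(x)$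 is the object of $t\Delta_+$ with $A(x)_m=\{y\in A_{m+1} : y\mapsto x\text{ under }A_{m+1}\to A_1\}$, with $p$, $F$, $\lambda$ restricted; a morphism $(f,\alpha)\colon(B,G)\to(A,F)$ restricts, for $x\in A_1$, to $f(x)\colon B(f_1x)\to A(x)$. The functor $\Xi_{\Delta}$. Trivial objects go to $[-1]$. A nontrivial $(B,G)$, with bijections $\eta_n$, goes to $K$ with $\mathrm{Ob}\,K=G_0(\ast)$ and $K(\eta_{0,x})=\Xi_{\Delta}(B(x))$ for each $x\in B_1$. A morphism with trivial domain goes to the unique morphism out of $[-1]$; any other $(f,\alpha)\colon(B,G)\to(A,F)$ goes to the morphism $g$ with object map $\alpha_{0,\ast}\colon G_0(\ast)\to F_0(\ast)$ and $g(\lambda_{0,x})=\Xi_{\Delta}(f(x))$ for each $x\in A_1$. *)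

theory Defs
  imports Main "HOL-Library.FuncSet"
begin

section \<open>Categories, functors, equivalences\<close>

text \<open>
  Hom-sets carry the information about source and target: the hom-sets need not be disjoint, and
  composition is indexed by objects, \<open>Cmp C X Y Z g f\<close> being the composite of
  \<open>f : X \<rightarrow> Y\<close> and \<open>g : Y \<rightarrow> Z\<close>.
\<close>

record ('o, 'm) cat =
  Obj :: "'o set"
  Hom :: "'o \<Rightarrow> 'o \<Rightarrow> 'm set"
  Idn :: "'o \<Rightarrow> 'm"
  Cmp :: "'o \<Rightarrow> 'o \<Rightarrow> 'o \<Rightarrow> 'm \<Rightarrow> 'm \<Rightarrow> 'm"

definition is_category :: "('o, 'm) cat \<Rightarrow> bool" where
  "is_category C \<longleftrightarrow>
     (\<forall>X \<in> Obj C. Idn C X \<in> Hom C X X) \<and>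
     (\<forall>X \<in> Obj C. \<forall>Y \<in> Obj C. \<forall>Z \<in> Obj C. \<forall>f \<in> Hom C X Y. \<forall>g \<in> Hom C Y Z.
        Cmp C X Y Z g f \<in> Hom C X Z) \<and>
     (\<forall>X \<in> Obj C. \<forall>Y \<in> Obj C. \<forall>f \<in> Hom C X Y.
        Cmp C X X Y f (Idn C X) = f \<and> Cmp C X Y Y (Idn C Y) f = f) \<and>
     (\<forall>W \<in> Obj C. \<forall>X \<in> Obj C. \<forall>Y \<in> Obj C. \<forall>Z \<in> Obj C.
        \<forall>f \<in> Hom C W X. \<forall>g \<in> Hom C X Y. \<forall>h \<in> Hom C Y Z.
          Cmp C W Y Z h (Cmp C W X Y g f) = Cmp C W X Z (Cmp C X Y Z h g) f)"

definition is_iso :: "('o, 'm) cat \<Rightarrow> 'o \<Rightarrow> 'o \<Rightarrow> 'm \<Rightarrow> bool" where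
  "is_iso C X Y f \<longleftrightarrow> f \<in> Hom C X Y \<and>
     (\<exists>g \<in> Hom C Y X. Cmp C X Y X g f = Idn C X \<and> Cmp C Y X Y f g = Idn C Y)"

record ('o, 'm, 'p, 'n) fctr =
  FOb :: "'o \<Rightarrow> 'p"
  FHom :: "'o \<Rightarrow> 'o \<Rightarrow> 'm \<Rightarrow> 'n"

definition is_functor ::
  "('o, 'm) cat \<Rightarrow> ('p, 'n) cat \<Rightarrow> ('o, 'm, 'p, 'n) fctr \<Rightarrow> bool" where
  "is_functor C D F \<longleftrightarrow>
     (\<forall>X \<in> Obj C. FOb F X \<in> Obj D) \<and>
     (\<forall>X \<in> Obj C. \<forall>Y \<in> Obj C. \<forall>f \<in> Hom C X Y. FHom F X Y f \<in> Hom D (FOb F X) (FOb F Y)) \<and>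
     (\<forall>X \<in> Obj C. FHom F X X (Idn C X) = Idn D (FOb F X)) \<and>
     (\<forall>X \<in> Obj C. \<forall>Y \<in> Obj C. \<forall>Z \<in> Obj C. \<forall>f \<in> Hom C X Y. \<forall>g \<in> Hom C Y Z.
        FHom F X Z (Cmp C X Y Z g f) =
        Cmp D (FOb F X) (FOb F Y) (FOb F Z) (FHom F Y Z g) (FHom F X Y f))"

definition id_fctr :: "('o, 'm, 'o, 'm) fctr" where
  "id_fctr = \<lparr>FOb = (\<lambda>X. X), FHom = (\<lambda>X Y f. f)\<rparr>"

definition comp_fctr ::
  "('p, 'n, 'q, 'k) fctr \<Rightarrow> ('o, 'm, 'p, 'n) fctr \<Rightarrow> ('o, 'm, 'q, 'k) fctr" where
  "comp_fctr G F = \<lparr>FOb = (\<lambda>X. FOb G (FOb F X)),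
                     FHom = (\<lambda>X Y f. FHom G (FOb F X) (FOb F Y) (FHom F X Y f))\<rparr>"

definition is_nat_iso ::
  "('o, 'm) cat \<Rightarrow> ('p, 'n) cat \<Rightarrow> ('o, 'm, 'p, 'n) fctr \<Rightarrow> ('o, 'm, 'p, 'n) fctr \<Rightarrow>
   ('o \<Rightarrow> 'n) \<Rightarrow> bool" where
  "is_nat_iso C D F G \<tau> \<longleftrightarrow>
     (\<forall>X \<in> Obj C. is_iso D (FOb F X) (FOb G X) (\<tau> X)) \<and>
     (\<forall>X \<in> Obj C. \<forall>Y \<in> Obj C. \<forall>f \<in> Hom C X Y.
        Cmp D (FOb F X) (FOb F Y) (FOb G Y) (\<tau> Y) (FHom F X Y f) =
        Cmp D (FOb F X) (FOb G X) (FOb G Y) (FHom G X Y f) (\<tau> X))"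

definition is_equivalence ::
  "('o, 'm) cat \<Rightarrow> ('p, 'n) cat \<Rightarrow> ('o, 'm, 'p, 'n) fctr \<Rightarrow> bool" where
  "is_equivalence C D F \<longleftrightarrow>
     is_category C \<and> is_category D \<and> is_functor C D F \<and>
     (\<exists>G. is_functor D C G \<and>
        (\<exists>\<eta>. is_nat_iso C C id_fctr (comp_fctr G F) \<eta>) \<and>
        (\<exists>\<epsilon>. is_nat_iso D D (comp_fctr F G) id_fctr \<epsilon>))"

section \<open>Ordinals\<close>

text \<open>
  The ordinal \<open>[n]\<close>, for \<open>n \<ge> -1\<close>, is represented by its number of elements \<open>a = n + 1\<close>, and its
  set of elements is \<open>{..<a}\<close>. So \<open>[-1]\<close> is \<open>0\<close>, and \<open>[n]\<^sup>\<and> = [n + 1]\<close> has the set of elements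
  \<open>{..a}\<close>.
\<close>

definition ord_maps :: "nat \<Rightarrow> nat \<Rightarrow> (nat \<Rightarrow> nat) set" where
  "ord_maps a b = {g \<in> {..<a} \<rightarrow>\<^sub>E {..<b}. mono_on {..<a} g}"

text \<open>
  For \<open>g\<close> with domain the ordinal \<open>a\<close>, \<open>wedge a g\<close> is \<open>g\<^sup>\<and>\<close>; its values matter only at elements
  of \<open>{..b}\<close>, where \<open>b\<close> is the codomain of \<open>g\<close>.
\<close>

definition wedge :: "nat \<Rightarrow> (nat \<Rightarrow> nat) \<Rightarrow> nat \<Rightarrow> nat" where
  "wedge a g j = Min ({i \<in> {..<a}. j \<le> g i} \<union> {a})"

definition wedge_endpoint :: "nat \<Rightarrow> nat \<Rightarrow> bool" where
  "wedge_endpoint a j \<longleftrightarrow> j = 0 \<or> j = a"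

section \<open>The category \<open>i\<Delta>\<^sub>+\<close>\<close>

datatype iobj =
    ITriv
  | INode (iord: nat) (ifib: "nat \<Rightarrow> iobj")
  where "iord ITriv = 0"

text \<open>
  The height is a bound and not part of the data: an object of height \<open>n \<ge> 1\<close> is also an object of
  every larger height. The conjunct \<open>0 < a\<close> says that only the trivial object has underlying
  ordinal \<open>[-1]\<close>. Families indexed by \<open>{..a}\<close> are extensional, so that equality of terms is
  equality of objects.
\<close>

inductive of_height :: "nat \<Rightarrow> iobj \<Rightarrow> bool" where
  height_triv: "of_height 0 ITriv"
| height_node: "of_height n (INode a K)"
    if "1 \<le> n" and "0 < a" and "K \<in> extensional {..a}"
      and "\<forall>j \<in> {..a}. \<exists>m<n. of_height m (K j)"
      and "\<forall>j \<in> {..a}. K j = ITriv \<longleftrightarrow> wedge_endpoint a j"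

definition iobjs :: "iobj set" where
  "iobjs = {K. \<exists>n. of_height n K}"

datatype imor =
    IInit
  | IMap "nat \<Rightarrow> nat" "nat \<Rightarrow> imor"

inductive is_imor :: "iobj \<Rightarrow> iobj \<Rightarrow> imor \<Rightarrow> bool" where
  imor_init: "is_imor ITriv K IInit"
| imor_map: "is_imor (INode a H) (INode b K) (IMap g \<gamma>)"
    if "g \<in> ord_maps a b" and "\<gamma> \<in> extensional {..b}"
      and "\<forall>j \<in> {..b}. is_imor (H (wedge a g j)) (K j) (\<gamma> j)"

primrec i_id :: "iobj \<Rightarrow> imor" where
  "i_id ITriv = IInit"
| "i_id (INode a K) = IMap (\<lambda>i \<in> {..<a}. i) (\<lambda>j \<in> {..a}. i_id (K j))"

text \<open>\<open>i_comp g H K L f\<close> is the composite of \<open>f : H \<rightarrow> K\<close> and \<open>g : K \<rightarrow> L\<close>.\<close>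

primrec i_comp :: "imor \<Rightarrow> iobj \<Rightarrow> iobj \<Rightarrow> iobj \<Rightarrow> imor \<Rightarrow> imor" where
  "i_comp IInit H K L f = IInit"
| "i_comp (IMap g \<gamma>) H K L f =
     (case f of
        IInit \<Rightarrow> IInit
      | IMap h \<phi> \<Rightarrow>
          IMap (\<lambda>i \<in> {..<iord H}. g (h i))
            (\<lambda>j \<in> {..iord L}.
               i_comp (\<gamma> j)
                 (ifib H (wedge (iord H) h (wedge (iord K) g j)))
                 (ifib K (wedge (iord K) g j))
                 (ifib L j)
                 (\<phi> (wedge (iord K) g j))))"

definition iDelta :: "(iobj, imor) cat" where
  "iDelta = \<lparr>Obj = iobjs,
              Hom = (\<lambda>H K. {g. is_imor H K g}),
              Idn = i_id,
              Cmp = (\<lambda>H K L g f. i_comp g H K L f)\<rparr>"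

section \<open>Trees\<close>

text \<open>
  The sets of a tree are subsets of a type \<open>'a\<close>. As with all functions below, the maps \<open>par n\<close> are
  extensional on their domain.
\<close>

record 'a tree =
  nodes :: "nat \<Rightarrow> 'a set"
  par :: "nat \<Rightarrow> 'a \<Rightarrow> 'a"

definition is_tree :: "('a, 'z) tree_scheme \<Rightarrow> bool" where
  "is_tree T \<longleftrightarrow> (\<exists>r. nodes T 0 = {r}) \<and> (\<forall>n. par T n \<in> nodes T (Suc n) \<rightarrow>\<^sub>E nodes T n)"

definition root :: "('a, 'z) tree_scheme \<Rightarrow> 'a" where
  "root T = the_elem (nodes T 0)"

text \<open>The composite \<open>A\<^bsub>n+m\<^esub> \<rightarrow> A\<^sub>n\<close> of the maps \<open>p\<close>.\<close>

primrec par_comp :: "('a, 'z) tree_scheme \<Rightarrow> nat \<Rightarrow> nat \<Rightarrow> 'a \<Rightarrow> 'a" where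
  "par_comp T n 0 y = y"
| "par_comp T n (Suc m) y = par_comp T n m (par T (n + m) y)"

definition has_degree :: "('a, 'z) tree_scheme \<Rightarrow> nat \<Rightarrow> bool" where
  "has_degree T n \<longleftrightarrow> (\<forall>m\<ge>1. bij_betw (par_comp T n m) (nodes T (n + m)) (nodes T n))"

definition is_tree_map ::
  "('a, 'y) tree_scheme \<Rightarrow> ('b, 'z) tree_scheme \<Rightarrow> (nat \<Rightarrow> 'a \<Rightarrow> 'b) \<Rightarrow> bool" where
  "is_tree_map A B f \<longleftrightarrow>
     (\<forall>n. f n \<in> nodes A n \<rightarrow>\<^sub>E nodes B n) \<and>
     (\<forall>n. \<forall>x \<in> nodes A (Suc n). par B n (f (Suc n) x) = f n (par A n x))"

section \<open>The category \<open>t\<Delta>\<^sub>+\<close>\<close>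

text \<open>
  \<open>ford T n y\<close> is the ordinal \<open>F\<^sub>n(y)\<close>, and \<open>lab T n x\<close> is the second component of
  \<open>\<lambda>\<^sub>n(x)\<close>, for \<open>x\<close> in \<open>A\<^bsub>n+1\<^esub>\<close>.
\<close>

record 'a tobj = "'a tree" +
  ford :: "nat \<Rightarrow> 'a \<Rightarrow> nat"
  lab :: "nat \<Rightarrow> 'a \<Rightarrow> nat"

definition cropped :: "'a tobj \<Rightarrow> bool" where
  "cropped T \<longleftrightarrow> (\<forall>n. \<forall>x \<in> nodes T (Suc n).
     wedge_endpoint (ford T n (par T n x)) (lab T n x) \<longleftrightarrow> ford T (Suc n) x = 0)"

definition tobjs :: "'a tobj set" where
  "tobjs = {T. is_tree T \<and> (\<exists>n. has_degree T n) \<and>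
     (\<forall>n. ford T n \<in> extensional (nodes T n)) \<and>
     (\<forall>n. lab T n \<in> extensional (nodes T (Suc n))) \<and>
     (\<forall>n. bij_betw (\<lambda>x. (par T n x, lab T n x))
            (nodes T (Suc n)) (SIGMA y : nodes T n. {..ford T n y})) \<and>
     cropped T}"

definition t_trivial :: "'a tobj \<Rightarrow> bool" where
  "t_trivial T \<longleftrightarrow> has_degree T 0"

record 'a tmor =
  tmap :: "nat \<Rightarrow> 'a \<Rightarrow> 'a"
  omap :: "nat \<Rightarrow> 'a \<Rightarrow> nat \<Rightarrow> nat"

definition t_hom :: "'a tobj \<Rightarrow> 'a tobj \<Rightarrow> 'a tmor set" where
  "t_hom B A = {\<phi>. is_tree_map A B (tmap \<phi>) \<and>
     (\<forall>n. omap \<phi> n \<in> extensional (nodes A n)) \<and>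
     (\<forall>n. \<forall>x \<in> nodes A n. omap \<phi> n x \<in> ord_maps (ford B n (tmap \<phi> n x)) (ford A n x)) \<and>
     (\<forall>n. \<forall>x \<in> nodes A (Suc n).
        lab B n (tmap \<phi> (Suc n) x) =
        wedge (ford B n (tmap \<phi> n (par A n x))) (omap \<phi> n (par A n x)) (lab A n x))}"

definition t_id :: "'a tobj \<Rightarrow> 'a tmor" where
  "t_id A = \<lparr>tmap = (\<lambda>n. \<lambda>x \<in> nodes A n. x),
             omap = (\<lambda>n. \<lambda>x \<in> nodes A n. \<lambda>i \<in> {..<ford A n x}. i)\<rparr>"

text \<open>The composite of \<open>\<psi> : C \<rightarrow> B\<close> and then \<open>\<phi> : B \<rightarrow> A\<close>; its tree map goes from \<open>A\<close> to \<open>C\<close>.\<close>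

definition t_comp :: "'a tobj \<Rightarrow> 'a tobj \<Rightarrow> 'a tobj \<Rightarrow> 'a tmor \<Rightarrow> 'a tmor \<Rightarrow> 'a tmor" where
  "t_comp C B A \<phi> \<psi> =
     \<lparr>tmap = (\<lambda>n. \<lambda>x \<in> nodes A n. tmap \<psi> n (tmap \<phi> n x)),
      omap = (\<lambda>n. \<lambda>x \<in> nodes A n. \<lambda>i \<in> {..<ford C n (tmap \<psi> n (tmap \<phi> n x))}.
                omap \<phi> n x (omap \<psi> n (tmap \<phi> n x) i))\<rparr>"

definition tDelta :: "('a tobj, 'a tmor) cat" where
  "tDelta = \<lparr>Obj = tobjs, Hom = t_hom, Idn = t_id, Cmp = t_comp\<rparr>"

definition restr_nodes :: "'a tobj \<Rightarrow> 'a \<Rightarrow> nat \<Rightarrow> 'a set" where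
  "restr_nodes A x m = {y \<in> nodes A (Suc m). par_comp A 1 m y = x}"

definition t_restr :: "'a tobj \<Rightarrow> 'a \<Rightarrow> 'a tobj" where
  "t_restr A x =
     \<lparr>nodes = restr_nodes A x,
      par = (\<lambda>m. restrict (par A (Suc m)) (restr_nodes A x (Suc m))),
      ford = (\<lambda>m. restrict (ford A (Suc m)) (restr_nodes A x m)),
      lab = (\<lambda>m. restrict (lab A (Suc m)) (restr_nodes A x (Suc m)))\<rparr>"

text \<open>The restriction \<open>f(x) : B(f\<^sub>1 x) \<rightarrow> A(x)\<close> of a morphism into \<open>A\<close>.\<close>

definition t_restr_mor :: "'a tobj \<Rightarrow> 'a \<Rightarrow> 'a tmor \<Rightarrow> 'a tmor" where
  "t_restr_mor A x \<phi> =
     \<lparr>tmap = (\<lambda>m. restrict (tmap \<phi> (Suc m)) (restr_nodes A x m)),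
      omap = (\<lambda>m. restrict (omap \<phi> (Suc m)) (restr_nodes A x m))\<rparr>"

section \<open>The functor \<open>\<Xi>\<^sub>\<Delta>\<close>\<close>

definition degree :: "'a tobj \<Rightarrow> nat" where
  "degree T = (LEAST n. has_degree T n)"

lemma par_comp_add: "par_comp T n (a + b) y = par_comp T n a (par_comp T (n + a) b y)"
  by (induction b arbitrary: y) (simp_all add: add.assoc)

lemma par_restr_nodes:
  assumes "y \<in> restr_nodes A x (Suc m)" and "par A (Suc m) y \<in> nodes A (Suc m)"
  shows "par A (Suc m) y \<in> restr_nodes A x m"
  using assms by (simp add: restr_nodes_def)

lemma par_comp_restr:
  assumes "is_tree A" and "y \<in> restr_nodes A x (n + m)"
  shows "par_comp (t_restr A x) n m y = par_comp A (Suc n) m y"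
  using assms(2)
proof (induction m arbitrary: y)
  case 0
  then show ?case by simp
next
  case (Suc m)
  have y: "y \<in> restr_nodes A x (Suc (n + m))"
    using Suc.prems by simp
  then have "par A (Suc (n + m)) y \<in> nodes A (Suc (n + m))"
    using assms(1) unfolding is_tree_def restr_nodes_def by blast
  then have "par A (Suc (n + m)) y \<in> restr_nodes A x (n + m)"
    by (rule par_restr_nodes[OF y])
  then show ?case
    using Suc.IH y by (simp add: t_restr_def)
qed

lemma bij_betw_preimage:
  assumes "bij_betw f A B"
  shows "bij_betw f {y \<in> A. P (f y)} {z \<in> B. P z}"
  using assms by (auto simp: bij_betw_def inj_on_def)

lemma has_degree_restr:
  assumes "is_tree A" and "has_degree A (Suc d)"
  shows "has_degree (t_restr A x) d"
  unfolding has_degree_def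
proof (intro allI impI)
  fix m :: nat
  assume "1 \<le> m"
  then have "bij_betw (par_comp A (Suc d) m) (nodes A (Suc d + m)) (nodes A (Suc d))"
    using assms(2) by (simp add: has_degree_def)
  then have "bij_betw (par_comp A (Suc d) m)
      {y \<in> nodes A (Suc d + m). par_comp A 1 d (par_comp A (Suc d) m y) = x}
      {z \<in> nodes A (Suc d). par_comp A 1 d z = x}"
    by (rule bij_betw_preimage)
  then have "bij_betw (par_comp A (Suc d) m) (restr_nodes A x (d + m)) (restr_nodes A x d)"
    by (simp add: restr_nodes_def par_comp_add)
  then have "bij_betw (par_comp (t_restr A x) d m) (restr_nodes A x (d + m)) (restr_nodes A x d)"
    using par_comp_restr[OF assms(1)] by (simp cong: bij_betw_cong)
  then show "bij_betw (par_comp (t_restr A x) d m)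
      (nodes (t_restr A x) (d + m)) (nodes (t_restr A x) d)"
    by (simp add: t_restr_def)
qed

lemma degree_restr_less:
  assumes "T \<in> tobjs" and "\<not> t_trivial T"
  shows "degree (t_restr T x) < degree T"
proof -
  have tree: "is_tree T" and deg: "has_degree T (degree T)"
    using assms(1) by (auto simp: tobjs_def degree_def intro: LeastI)
  then have "degree T \<noteq> 0"
    using assms(2) by (metis t_trivial_def)
  then obtain d where d: "degree T = Suc d"
    using not0_implies_Suc by blast
  then have "has_degree (t_restr T x) d"
    using has_degree_restr[OF tree] deg by simp
  then have "degree (t_restr T x) \<le> d"
    unfolding degree_def by (rule Least_le)
  then show ?thesis
    using d by simp
qed

text \<open>
  For \<open>T\<close> in \<open>tobjs\<close>, \<open>\<lambda>\<^sub>0\<close> is essentially a bijection from \<open>A\<^sub>1\<close> to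
  \<open>F\<^sub>0(\<ast>)\<^sup>\<and>\<close>, since \<open>A\<^sub>0\<close> is a singleton; \<open>child T\<close> is its inverse, so that the clauses
  for \<open>j = \<lambda>\<^bsub>0,x\<^esub>\<close>, \<open>x\<close> in \<open>A\<^sub>1\<close>, below are indexed by \<open>j\<close> with \<open>x = child T j\<close>.
  The value outside \<open>tobjs\<close> is irrelevant.
\<close>

definition child :: "'a tobj \<Rightarrow> nat \<Rightarrow> 'a" where
  "child T = the_inv_into (nodes T 1) (lab T 0)"

function Xi_ob :: "'a tobj \<Rightarrow> iobj" where
  "Xi_ob B =
     (if B \<notin> tobjs then undefined
      else if t_trivial B then ITriv
      else INode (ford B 0 (root B))
             (\<lambda>j \<in> {..ford B 0 (root B)}. Xi_ob (t_restr B (child B j))))"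
  by pat_completeness auto
termination
  by (relation "measure degree") (auto intro: degree_restr_less)

function Xi_mor :: "'a tobj \<Rightarrow> 'a tobj \<Rightarrow> 'a tmor \<Rightarrow> imor" where
  "Xi_mor B A \<phi> =
     (if B \<notin> tobjs then undefined
      else if t_trivial B then IInit
      else IMap (omap \<phi> 0 (root A))
             (\<lambda>j \<in> {..ford A 0 (root A)}.
                Xi_mor (t_restr B (tmap \<phi> 1 (child A j))) (t_restr A (child A j))
                       (t_restr_mor A (child A j) \<phi>)))"
  by pat_completeness auto
termination
  by (relation "measure (\<lambda>(B, A, \<phi>). degree B)") (auto intro: degree_restr_less)

declare Xi_ob.simps [simp del] Xi_mor.simps [simp del]

definition Xi_Delta :: "('a tobj, 'a tmor, iobj, imor) fctr" where
  "Xi_Delta = \<lparr>FOb = Xi_ob, FHom = Xi_mor\<rparr>"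

end

theory Submission
  imports Defs "HOL-Library.Countable"
begin

text \<open>
  A functor is an equivalence as soon as it is fully faithful and surjective on objects, so the
  claim comes down to these two properties of \<open>\<Xi>\<^sub>\<Delta>\<close>.

  A tree of degree \<open>d + 1\<close> is its root together with the restrictions \<open>A(x)\<close>, \<open>x \<in> A\<^sub>1\<close>, which have
  degree \<open>d\<close>; this is the shape of the recursion that defines \<open>i\<Delta>\<^sub>+\<close>. Statements about
  \<open>\<Xi>\<^sub>\<Delta>\<close> are therefore proved by induction on the degree (\<open>tobjs_induct\<close>), and the induction step
  needs only to know how \<open>t\<Delta>\<^sub>+\<close> behaves at the root. For a morphism \<open>(f, \<alpha>)\<close> from \<open>B\<close> to
  \<open>A\<close>, the condition on labels forces \<open>f\<^sub>1\<close> to be \<open>(\<alpha>\<^bsub>0,\<ast>\<^esub>)\<^sup>\<and>\<close> when the children of a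
  root are identified with their labels (\<open>tmap_child\<close>). What remains is an order-preserving map of the
  root ordinals and, for each child \<open>x\<close> of the root of \<open>A\<close>, a morphism from \<open>B(f\<^sub>1 x)\<close> to \<open>A(x)\<close>.
  Such data determine the morphism (\<open>t_hom_eqI_restr\<close>) and may be chosen freely (\<open>t_hom_glue\<close>),
  because the trees \<open>A(x)\<close> partition the nodes of \<open>A\<close> above the root. As a morphism of
  \<open>i\<Delta>\<^sub>+\<close> between nontrivial objects consists of exactly the same data one level down, fullness
  and faithfulness pass from the restrictions to the tree. The induction starts at trivial trees, which
  are initial in \<open>t\<Delta>\<^sub>+\<close> (\<open>ex1_t_hom_from_trivial\<close>), as \<open>[-1]\<close> is in \<open>i\<Delta>\<^sub>+\<close>.

  For surjectivity on objects, an object \<open>K\<close> is turned into the tree whose nodes are the paths in \<open>K\<close>,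
  that is, the lists of successive choices of an index \<open>j\<close> of a fibre (\<open>path_tree\<close>). Paths are finite
  lists of natural numbers, so they embed into every infinite set of nodes.
\<close>

section \<open>Fully faithful functors that are surjective on objects\<close>

text \<open>
  The inverse functor \<open>G\<close> chooses a preimage of every object and takes preimages of morphisms under
  the bijections of hom-sets. Then \<open>F \<circ> G\<close> is the identity on the nose, with identities as counit,
  and the unit \<open>\<eta>\<close> at \<open>X\<close> is the morphism that \<open>F\<close> sends to the identity of \<open>F X\<close>. All
  equations in \<open>C\<close> are checked after applying \<open>F\<close>.
\<close>

lemma equivalence_if_fully_faithful_surj:
  assumes C: "is_category C" and D: "is_category D" and F: "is_functor C D F"
    and ff: "\<And>X Y. X \<in> Obj C \<Longrightarrow> Y \<in> Obj C \<Longrightarrow>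
      bij_betw (FHom F X Y) (Hom C X Y) (Hom D (FOb F X) (FOb F Y))"
    and surj: "FOb F ` Obj C = Obj D"
  shows "is_equivalence C D F"
proof -
  have C_id: "\<And>X. X \<in> Obj C \<Longrightarrow> Idn C X \<in> Hom C X X"
    and C_comp: "\<And>X Y Z f g. X \<in> Obj C \<Longrightarrow> Y \<in> Obj C \<Longrightarrow> Z \<in> Obj C \<Longrightarrow> f \<in> Hom C X Y \<Longrightarrow>
      g \<in> Hom C Y Z \<Longrightarrow> Cmp C X Y Z g f \<in> Hom C X Z"
    using C unfolding is_category_def by blast+
  have D_id: "\<And>X. X \<in> Obj D \<Longrightarrow> Idn D X \<in> Hom D X X"
    and D_comp: "\<And>X Y Z f g. X \<in> Obj D \<Longrightarrow> Y \<in> Obj D \<Longrightarrow> Z \<in> Obj D \<Longrightarrow> f \<in> Hom D X Y \<Longrightarrow>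
      g \<in> Hom D Y Z \<Longrightarrow> Cmp D X Y Z g f \<in> Hom D X Z"
    and D_unit: "\<And>X Y f. X \<in> Obj D \<Longrightarrow> Y \<in> Obj D \<Longrightarrow> f \<in> Hom D X Y \<Longrightarrow>
      Cmp D X X Y f (Idn D X) = f \<and> Cmp D X Y Y (Idn D Y) f = f"
    using D unfolding is_category_def by blast+
  have F_ob: "\<And>X. X \<in> Obj C \<Longrightarrow> FOb F X \<in> Obj D"
    and F_hom: "\<And>X Y f. X \<in> Obj C \<Longrightarrow> Y \<in> Obj C \<Longrightarrow> f \<in> Hom C X Y \<Longrightarrow>
      FHom F X Y f \<in> Hom D (FOb F X) (FOb F Y)"
    and F_id: "\<And>X. X \<in> Obj C \<Longrightarrow> FHom F X X (Idn C X) = Idn D (FOb F X)"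
    and F_comp: "\<And>X Y Z f g. X \<in> Obj C \<Longrightarrow> Y \<in> Obj C \<Longrightarrow> Z \<in> Obj C \<Longrightarrow> f \<in> Hom C X Y \<Longrightarrow>
      g \<in> Hom C Y Z \<Longrightarrow> FHom F X Z (Cmp C X Y Z g f) =
        Cmp D (FOb F X) (FOb F Y) (FOb F Z) (FHom F Y Z g) (FHom F X Y f)"
    using F unfolding is_functor_def by blast+
  define s where "s = inv_into (Obj C) (FOb F)"
  have s: "s X \<in> Obj C" "FOb F (s X) = X" if "X \<in> Obj D" for X
    using that surj unfolding s_def by (metis inv_into_into, metis f_inv_into_f)
  define lift where "lift X Y = inv_into (Hom C X Y) (FHom F X Y)" for X Y
  have lift: "lift X Y h \<in> Hom C X Y" "FHom F X Y (lift X Y h) = h"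
    if "X \<in> Obj C" "Y \<in> Obj C" "h \<in> Hom D (FOb F X) (FOb F Y)" for X Y h
    using that ff[of X Y] unfolding lift_def bij_betw_def
    by (metis inv_into_into, metis f_inv_into_f)
  have faithful: "f = g"
    if "X \<in> Obj C" "Y \<in> Obj C" "f \<in> Hom C X Y" "g \<in> Hom C X Y" "FHom F X Y f = FHom F X Y g"
    for X Y f g
    using that ff[of X Y] unfolding bij_betw_def inj_on_def by blast
  define G where "G = \<lparr>FOb = s, FHom = (\<lambda>X Y. lift (s X) (s Y))\<rparr>"
  note cat_intros = C_id C_comp D_id D_comp F_ob F_hom s lift
  have "lift (s X) (s X) (Idn D X) = Idn C (s X)" if "X \<in> Obj D" for X
    by (rule faithful[of "s X" "s X"]) (simp_all add: that cat_intros F_id)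
  moreover have "lift (s X) (s Z) (Cmp D X Y Z g f) =
      Cmp C (s X) (s Y) (s Z) (lift (s Y) (s Z) g) (lift (s X) (s Y) f)"
    if "X \<in> Obj D" "Y \<in> Obj D" "Z \<in> Obj D" "f \<in> Hom D X Y" "g \<in> Hom D Y Z" for X Y Z f g
    by (rule faithful[of "s X" "s Z"]) (use that in \<open>simp_all add: cat_intros F_comp\<close>)
  ultimately have G: "is_functor D C G"
    unfolding is_functor_def G_def by (simp add: cat_intros)
  define \<eta> where "\<eta> X = lift X (s (FOb F X)) (Idn D (FOb F X))" for X
  define \<theta> where "\<theta> X = lift (s (FOb F X)) X (Idn D (FOb F X))" for X
  have \<eta>: "\<eta> X \<in> Hom C X (s (FOb F X))" "FHom F X (s (FOb F X)) (\<eta> X) = Idn D (FOb F X)"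
    and \<theta>: "\<theta> X \<in> Hom C (s (FOb F X)) X" "FHom F (s (FOb F X)) X (\<theta> X) = Idn D (FOb F X)"
    if "X \<in> Obj C" for X
    using that unfolding \<eta>_def \<theta>_def by (simp_all add: cat_intros)
  have "is_iso C X (s (FOb F X)) (\<eta> X)" if X: "X \<in> Obj C" for X
    unfolding is_iso_def
  proof (intro conjI bexI[of _ "\<theta> X"])
    have sX: "s (FOb F X) \<in> Obj C"
      by (simp add: X cat_intros)
    show "Cmp C X (s (FOb F X)) X (\<theta> X) (\<eta> X) = Idn C X"
      by (rule faithful[of X X]) (simp_all add: X sX \<eta> \<theta> cat_intros F_comp F_id D_unit)
    show "Cmp C (s (FOb F X)) X (s (FOb F X)) (\<eta> X) (\<theta> X) = Idn C (s (FOb F X))"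
      by (rule faithful[of "s (FOb F X)" "s (FOb F X)"])
        (simp_all add: X sX \<eta> \<theta> cat_intros F_comp F_id D_unit)
  qed (simp_all add: X \<eta> \<theta>)
  moreover have "Cmp C X Y (s (FOb F Y)) (\<eta> Y) f =
      Cmp C X (s (FOb F X)) (s (FOb F Y)) (lift (s (FOb F X)) (s (FOb F Y)) (FHom F X Y f)) (\<eta> X)"
    if XY: "X \<in> Obj C" "Y \<in> Obj C" "f \<in> Hom C X Y" for X Y f
    by (rule faithful[of X "s (FOb F Y)"]) (simp_all add: XY \<eta> cat_intros F_comp D_unit)
  ultimately have "is_nat_iso C C id_fctr (comp_fctr G F) \<eta>"
    unfolding is_nat_iso_def id_fctr_def comp_fctr_def G_def by simp
  moreover have "is_nat_iso D D (comp_fctr F G) id_fctr (Idn D)"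
    unfolding is_nat_iso_def id_fctr_def comp_fctr_def G_def is_iso_def
    by (auto simp: cat_intros D_unit intro!: bexI)
  ultimately show ?thesis
    unfolding is_equivalence_def using C D F G by blast
qed

section \<open>Order-preserving maps of ordinals and their duals\<close>

lemma wedge_le: "wedge a g j \<le> a"
  unfolding wedge_def by (rule Min_le) auto

text \<open>
  An order-preserving \<open>g\<close> and \<open>g\<^sup>\<and>\<close> form a Galois connection. As \<open>g\<^sup>\<and>\<close> takes values in \<open>{..a}\<close>,
  this determines it, and all identities for \<open>g\<^sup>\<and>\<close> below follow.
\<close>

lemma wedge_le_iff:
  assumes "mono_on {..<a} g" and "i < a"
  shows "wedge a g j \<le> i \<longleftrightarrow> j \<le> g i"
proof
  assume "wedge a g j \<le> i"
  moreover have "wedge a g j \<in> {i \<in> {..<a}. j \<le> g i} \<union> {a}"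
    unfolding wedge_def by (rule Min_in) auto
  ultimately have "wedge a g j < a" and "j \<le> g (wedge a g j)"
    using assms(2) by auto
  then show "j \<le> g i"
    using mono_onD[OF assms(1), of "wedge a g j" i] \<open>wedge a g j \<le> i\<close> assms(2) by simp
next
  assume "j \<le> g i"
  then show "wedge a g j \<le> i"
    unfolding wedge_def using assms(2) by (intro Min_le) auto
qed

lemma eq_if_same_bounds:
  fixes x y a :: nat
  assumes "x \<le> a" and "y \<le> a" and "\<And>i. i < a \<Longrightarrow> x \<le> i \<longleftrightarrow> y \<le> i"
  shows "x = y"
  by (metis assms le_neq_implies_less order_antisym order_refl nat_le_linear)

lemma ord_maps_mono: "g \<in> ord_maps a b \<Longrightarrow> mono_on {..<a} g"
  and ord_maps_less: "g \<in> ord_maps a b \<Longrightarrow> i < a \<Longrightarrow> g i < b"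
  by (auto simp: ord_maps_def)

lemma ord_maps_id: "(\<lambda>i \<in> {..<a}. i) \<in> ord_maps a a"
  by (auto simp: ord_maps_def mono_on_def)

lemma ord_maps_comp:
  "g \<in> ord_maps a b \<Longrightarrow> h \<in> ord_maps b c \<Longrightarrow> (\<lambda>i \<in> {..<a}. h (g i)) \<in> ord_maps a c"
  by (auto simp: ord_maps_def mono_on_def PiE_def Pi_iff)

lemma ord_maps_0: "ord_maps 0 b = {\<lambda>_. undefined}"
  by (auto simp: ord_maps_def mono_on_def)

lemma ord_maps_to_0: "g \<in> ord_maps a 0 \<Longrightarrow> a = 0"
  by (auto simp: ord_maps_def)

lemma wedge_id: "j \<le> a \<Longrightarrow> wedge a (\<lambda>i \<in> {..<a}. i) j = j"
  by (rule eq_if_same_bounds[of _ a])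
    (auto simp: wedge_le wedge_le_iff[OF ord_maps_mono[OF ord_maps_id]])

lemma wedge_comp:
  assumes "g \<in> ord_maps a b" and "h \<in> ord_maps b c"
  shows "wedge a (\<lambda>i \<in> {..<a}. h (g i)) j = wedge a g (wedge b h j)"
  using assms ord_maps_comp[OF assms]
  by (intro eq_if_same_bounds[of _ a])
    (simp_all add: wedge_le wedge_le_iff ord_maps_mono ord_maps_less)

section \<open>The category \<open>i\<Delta>\<^sub>+\<close>\<close>

lemma of_height_nodeD:
  assumes "of_height n (INode a K)"
  shows "0 < a" and "K \<in> extensional {..a}"
    and "\<And>j. j \<le> a \<Longrightarrow> \<exists>m<n. of_height m (K j)"
    and "\<And>j. j \<le> a \<Longrightarrow> K j = ITriv \<longleftrightarrow> wedge_endpoint a j"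
  using assms by (cases rule: of_height.cases; simp)+

lemma iobjs_nodeD:
  assumes "INode a K \<in> iobjs"
  shows "0 < a" and "K \<in> extensional {..a}"
    and "\<And>j. j \<le> a \<Longrightarrow> K j \<in> iobjs"
    and "\<And>j. j \<le> a \<Longrightarrow> K j = ITriv \<longleftrightarrow> wedge_endpoint a j"
  using assms of_height_nodeD unfolding iobjs_def by blast+

text \<open>
  The index set of the fibres is finite, so the heights of the fibres have a common bound.
\<close>

lemma iobjs_nodeI:
  assumes "0 < a" and "K \<in> extensional {..a}" and "\<And>j. j \<le> a \<Longrightarrow> K j \<in> iobjs"
    and "\<And>j. j \<le> a \<Longrightarrow> K j = ITriv \<longleftrightarrow> wedge_endpoint a j"
  shows "INode a K \<in> iobjs"
proof -
  have "\<forall>j. \<exists>m. j \<le> a \<longrightarrow> of_height m (K j)"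
    using assms(3) by (simp add: iobjs_def)
  then obtain h where h: "\<And>j. j \<le> a \<Longrightarrow> of_height (h j) (K j)"
    by metis
  have "h j < Suc (Max (h ` {..a}))" if "j \<le> a" for j
    using that by (simp add: less_Suc_eq_le)
  then have "\<forall>j \<in> {..a}. \<exists>m < Suc (Max (h ` {..a})). of_height m (K j)"
    using h by blast
  then have "of_height (Suc (Max (h ` {..a}))) (INode a K)"
    using assms by (intro height_node) auto
  then show ?thesis
    unfolding iobjs_def by blast
qed

lemma is_imor_id: "K \<in> iobjs \<Longrightarrow> is_imor K K (i_id K)"
proof (induction K)
  case ITriv
  then show ?case by (simp add: imor_init)
next
  case (INode a K)
  then have "\<forall>j \<in> {..a}. is_imor (K (wedge a (\<lambda>i \<in> {..<a}. i) j)) (K j) (i_id (K j))"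
    using iobjs_nodeD(3) by (simp add: wedge_id)
  then show ?case
    by (auto intro: imor_map simp: ord_maps_id)
qed

text \<open>
  The components over \<open>j\<close> are composable because \<open>(g \<circ> h)\<^sup>\<and> = h\<^sup>\<and> \<circ> g\<^sup>\<and>\<close>.
\<close>

lemma is_imor_comp:
  "is_imor K L g \<Longrightarrow> is_imor H K f \<Longrightarrow> is_imor H L (i_comp g H K L f)"
proof (induction arbitrary: H f rule: is_imor.induct)
  case (imor_init L)
  then show ?case
    by (cases rule: is_imor.cases) (auto intro: is_imor.imor_init)
next
  case (imor_map g a b \<gamma> K L)
  from imor_map.prems show ?case
  proof (cases rule: is_imor.cases)
    case imor_init
    then show ?thesis by (auto intro: is_imor.imor_init)
  next
    case f: (imor_map h c \<phi> H')
    then show ?thesis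
      using imor_map.hyps imor_map.IH
      by (auto simp: ord_maps_comp wedge_comp wedge_le intro!: is_imor.imor_map)
  qed
qed

lemma i_comp_id_right: "is_imor H K f \<Longrightarrow> i_comp f H H K (i_id H) = f"
proof (induction rule: is_imor.induct)
  case (imor_map g a b \<gamma> H K)
  then have "(\<lambda>i \<in> {..<a}. g (restrict (\<lambda>i. i) {..<a} i)) = g"
    by (auto simp: ord_maps_def fun_eq_iff PiE_def extensional_def)
  then show ?case
    using imor_map by (auto simp: wedge_id wedge_le fun_eq_iff extensional_def)
qed simp

lemma i_comp_id_left: "is_imor H K f \<Longrightarrow> i_comp (i_id K) H K K f = f"
proof (induction rule: is_imor.induct)
  case (imor_init K)
  then show ?case by (cases K) simp_all
next
  case (imor_map g a b \<gamma> H K)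
  then have "(\<lambda>i \<in> {..<a}. restrict (\<lambda>i. i) {..<b} (g i)) = g"
    by (auto simp: ord_maps_def fun_eq_iff PiE_def extensional_def)
  then show ?case
    using imor_map by (auto simp: wedge_id wedge_le fun_eq_iff extensional_def)
qed

lemma i_comp_assoc:
  "is_imor Y Z h \<Longrightarrow> is_imor X Y g \<Longrightarrow> is_imor W X f \<Longrightarrow>
   i_comp h W Y Z (i_comp g W X Y f) = i_comp (i_comp h X Y Z g) W X Z f"
proof (induction arbitrary: W X f g rule: is_imor.induct)
  case (imor_map h b c \<gamma> Y Z)
  from imor_map.prems(1) show ?case
  proof (cases rule: is_imor.cases)
    case g: (imor_map g' a \<phi> X')
    from imor_map.prems(2)[unfolded g] show ?thesis
    proof (cases rule: is_imor.cases)
      case f: (imor_map f' d \<psi> W')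
      have "i_comp (\<gamma> j)
          (W' (wedge d (\<lambda>i \<in> {..<d}. g' (f' i)) (wedge b h j))) (Y (wedge b h j)) (Z j)
          (i_comp (\<phi> (wedge b h j))
            (W' (wedge d f' (wedge a g' (wedge b h j)))) (X' (wedge a g' (wedge b h j)))
            (Y (wedge b h j)) (\<psi> (wedge a g' (wedge b h j)))) =
        i_comp
          (i_comp (\<gamma> j) (X' (wedge a g' (wedge b h j))) (Y (wedge b h j)) (Z j)
            (\<phi> (wedge b h j)))
          (W' (wedge d f' (wedge a (\<lambda>i \<in> {..<a}. h (g' i)) j)))
          (X' (wedge a (\<lambda>i \<in> {..<a}. h (g' i)) j)) (Z j)
          (\<psi> (wedge a (\<lambda>i \<in> {..<a}. h (g' i)) j))"
        if "j \<le> c" for j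
        using f g imor_map.hyps imor_map.IH that
        by (simp add: wedge_comp wedge_le)
      then show ?thesis
        using f g by (auto simp: wedge_le fun_eq_iff ord_maps_less)
    qed (simp add: g)
  qed simp
qed simp

lemma is_category_iDelta: "is_category iDelta"
  unfolding is_category_def iDelta_def
  by (simp add: is_imor_id is_imor_comp i_comp_id_left i_comp_id_right i_comp_assoc)

section \<open>Labelled trees\<close>

lemma nodes_0: "T \<in> tobjs \<Longrightarrow> nodes T 0 = {root T}"
  by (auto simp: tobjs_def is_tree_def root_def)

lemma par_in: "T \<in> tobjs \<Longrightarrow> x \<in> nodes T (Suc n) \<Longrightarrow> par T n x \<in> nodes T n"
  by (auto simp: tobjs_def is_tree_def)

lemma lab_le: "T \<in> tobjs \<Longrightarrow> x \<in> nodes T (Suc n) \<Longrightarrow> lab T n x \<le> ford T n (par T n x)"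
  unfolding tobjs_def by (fastforce dest: bij_betwE)

lemma node_eqI:
  assumes "T \<in> tobjs" and "x \<in> nodes T (Suc n)" and "y \<in> nodes T (Suc n)"
    and "par T n x = par T n y" and "lab T n x = lab T n y"
  shows "x = y"
proof -
  have "inj_on (\<lambda>x. (par T n x, lab T n x)) (nodes T (Suc n))"
    using assms(1) by (auto simp: tobjs_def bij_betw_def)
  then show ?thesis
    by (rule inj_onD) (simp_all add: assms)
qed

lemma node_ex:
  assumes "T \<in> tobjs" and "y \<in> nodes T n" and "j \<le> ford T n y"
  obtains x where "x \<in> nodes T (Suc n)" and "par T n x = y" and "lab T n x = j"
proof -
  have "(y, j) \<in> (\<lambda>x. (par T n x, lab T n x)) ` nodes T (Suc n)"
    using assms by (auto simp: tobjs_def bij_betw_def)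
  then show ?thesis
    using that by auto
qed

lemma cropped_iff:
  "T \<in> tobjs \<Longrightarrow> x \<in> nodes T (Suc n) \<Longrightarrow>
   wedge_endpoint (ford T n (par T n x)) (lab T n x) \<longleftrightarrow> ford T (Suc n) x = 0"
  by (auto simp: tobjs_def cropped_def)

lemma par_0: "T \<in> tobjs \<Longrightarrow> x \<in> nodes T (Suc 0) \<Longrightarrow> par T 0 x = root T"
  using par_in nodes_0 by fastforce

lemma child:
  assumes "T \<in> tobjs" and "j \<le> ford T 0 (root T)"
  shows "child T j \<in> nodes T (Suc 0)" and "lab T 0 (child T j) = j"
proof -
  obtain x where x: "x \<in> nodes T (Suc 0)" "lab T 0 x = j"
    using node_ex[OF assms(1) _ assms(2)] nodes_0[OF assms(1)] by auto
  have "inj_on (lab T 0) (nodes T (Suc 0))"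
    by (rule inj_onI) (rule node_eqI[OF assms(1)], simp_all add: par_0[OF assms(1)])
  then have "child T j = x"
    using x by (auto simp: child_def the_inv_into_f_eq)
  with x show "child T j \<in> nodes T (Suc 0)" and "lab T 0 (child T j) = j"
    by simp_all
qed

lemma lab_0_le: "T \<in> tobjs \<Longrightarrow> x \<in> nodes T (Suc 0) \<Longrightarrow> lab T 0 x \<le> ford T 0 (root T)"
  using lab_le par_0 by fastforce

lemma child_lab: "T \<in> tobjs \<Longrightarrow> x \<in> nodes T (Suc 0) \<Longrightarrow> child T (lab T 0 x) = x"
  by (rule node_eqI[of T _ 0]) (simp_all add: child lab_0_le par_0)

lemma par_comp_in: "T \<in> tobjs \<Longrightarrow> y \<in> nodes T (n + m) \<Longrightarrow> par_comp T n m y \<in> nodes T n"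
  by (induction m arbitrary: y) (auto simp: par_in)

text \<open>
  Cropping forces every node above the root of a tree with \<open>F\<^sub>0(\<ast>) = [-1]\<close> to have the ordinal
  \<open>[-1]\<close> as well, so such a tree never branches.
\<close>

lemma nodes_if_ford_root_0:
  assumes "T \<in> tobjs" and "ford T 0 (root T) = 0"
  shows "\<exists>y. nodes T n = {y} \<and> ford T n y = 0"
proof (induction n)
  case 0
  then show ?case
    using assms nodes_0 by blast
next
  case (Suc n)
  then obtain y where y: "nodes T n = {y}" "ford T n y = 0"
    by blast
  obtain x where x: "x \<in> nodes T (Suc n)" "par T n x = y" "lab T n x = 0"
    using node_ex[OF assms(1), of y n 0] y by auto
  have "z = x" if "z \<in> nodes T (Suc n)" for z
    using node_eqI[OF assms(1) that x(1)] par_in[OF assms(1) that] lab_le[OF assms(1) that] x y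
    by auto
  then have "nodes T (Suc n) = {x}"
    using x by blast
  moreover have "ford T (Suc n) x = 0"
    using cropped_iff[OF assms(1) x(1)] x by (simp add: wedge_endpoint_def)
  ultimately show ?case by blast
qed

text \<open>
  If the root ordinal were nonempty, the two endpoints of \<open>F\<^sub>0(\<ast>)\<^sup>\<and>\<close> would label two different
  children of the root, so \<open>p\<^sub>0\<close> would not be injective.
\<close>

lemma trivial_iff: 
  assumes "T \<in> tobjs"
  shows "t_trivial T \<longleftrightarrow> ford T 0 (root T) = 0"
proof
  assume "t_trivial T"
  then have "bij_betw (par_comp T 0 1) (nodes T (0 + 1)) (nodes T 0)"
    unfolding t_trivial_def has_degree_def by blast
  then have "inj_on (par T 0) (nodes T (Suc 0))"
    by (simp add: bij_betw_def inj_on_def)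
  then have "child T 0 = child T (ford T 0 (root T))"
    by (rule inj_onD) (simp_all add: child[OF assms] par_0[OF assms])
  then have "lab T 0 (child T 0) = lab T 0 (child T (ford T 0 (root T)))"
    by simp
  then show "ford T 0 (root T) = 0"
    by (simp add: child[OF assms])
next
  assume *: "ford T 0 (root T) = 0"
  have "bij_betw (par_comp T 0 m) (nodes T (0 + m)) (nodes T 0)" for m
    using nodes_if_ford_root_0[OF assms *, of m] nodes_0[OF assms] par_comp_in[OF assms, of _ 0 m]
    by (auto simp: bij_betw_def)
  then show "t_trivial T"
    by (simp add: t_trivial_def has_degree_def)
qed

section \<open>Restrictions of labelled trees\<close>

lemma restr_nodes_0: "x \<in> nodes T (Suc 0) \<Longrightarrow> restr_nodes T x 0 = {x}"
  by (auto simp: restr_nodes_def)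

lemma restr_nodes_sub: "y \<in> restr_nodes T x m \<Longrightarrow> y \<in> nodes T (Suc m)"
  by (simp add: restr_nodes_def)

lemma par_in_restr:
  "T \<in> tobjs \<Longrightarrow> y \<in> restr_nodes T x (Suc m) \<Longrightarrow> par T (Suc m) y \<in> restr_nodes T x m"
  by (rule par_restr_nodes) (auto simp: restr_nodes_def intro: par_in)

lemma restr_nodes_iff_par:
  "T \<in> tobjs \<Longrightarrow> y \<in> nodes T (Suc (Suc m)) \<Longrightarrow>
   y \<in> restr_nodes T x (Suc m) \<longleftrightarrow> par T (Suc m) y \<in> restr_nodes T x m"
  by (auto simp: restr_nodes_def par_in)

text \<open>The child in question is the ancestor of \<open>y\<close> of level \<open>1\<close>.\<close>

lemma in_restr_nodes:
  assumes "T \<in> tobjs" and "y \<in> nodes T (Suc m)"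
  obtains j where "j \<le> ford T 0 (root T)" and "y \<in> restr_nodes T (child T j) m"
proof -
  have x: "par_comp T 1 m y \<in> nodes T (Suc 0)"
    using par_comp_in[of T y 1 m] assms by simp
  then show ?thesis
    using that[of "lab T 0 (par_comp T 1 m y)"] assms
    by (simp add: restr_nodes_def child_lab lab_0_le)
qed

lemma t_restr_simps [simp]:
  "nodes (t_restr T x) = restr_nodes T x"
  "y \<in> restr_nodes T x (Suc m) \<Longrightarrow> par (t_restr T x) m y = par T (Suc m) y"
  "y \<in> restr_nodes T x m \<Longrightarrow> ford (t_restr T x) m y = ford T (Suc m) y"
  "y \<in> restr_nodes T x (Suc m) \<Longrightarrow> lab (t_restr T x) m y = lab T (Suc m) y"
  by (simp_all add: t_restr_def)

lemma root_restr [simp]: "x \<in> nodes T (Suc 0) \<Longrightarrow> root (t_restr T x) = x"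
  by (simp add: root_def restr_nodes_0)

text \<open>
  Nontriviality gives a degree of the form \<open>d + 1\<close>, and restricting lowers it to \<open>d\<close>. The labelling
  restricts to a bijection because a node lies in \<open>A(x)\<close> exactly if its parent does.
\<close>

lemma restr_in_tobjs:
  assumes T: "T \<in> tobjs" and "\<not> t_trivial T" and x: "x \<in> nodes T (Suc 0)"
  shows "t_restr T x \<in> tobjs"
proof -
  have tree: "is_tree T" and "\<exists>n. has_degree T n"
    using T by (auto simp: tobjs_def)
  then obtain d where "has_degree T (Suc d)"
    using assms(2) by (metis t_trivial_def not0_implies_Suc)
  then have "has_degree (t_restr T x) d"
    by (rule has_degree_restr[OF tree])
  moreover have "is_tree (t_restr T x)"
    unfolding is_tree_def using T x by (auto simp: restr_nodes_0 par_in_restr t_restr_def)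
  moreover have "ford (t_restr T x) n \<in> extensional (restr_nodes T x n)"
    "lab (t_restr T x) n \<in> extensional (restr_nodes T x (Suc n))" for n
    by (simp_all add: t_restr_def)
  moreover have "bij_betw (\<lambda>y. (par (t_restr T x) n y, lab (t_restr T x) n y))
      (restr_nodes T x (Suc n)) (SIGMA y : restr_nodes T x n. {..ford (t_restr T x) n y})" for n
  proof (rule bij_betw_imageI)
    show "inj_on (\<lambda>y. (par (t_restr T x) n y, lab (t_restr T x) n y)) (restr_nodes T x (Suc n))"
      by (rule inj_onI, rule node_eqI[OF T]) (auto intro: restr_nodes_sub)
    show "(\<lambda>y. (par (t_restr T x) n y, lab (t_restr T x) n y)) ` restr_nodes T x (Suc n) =
        (SIGMA y : restr_nodes T x n. {..ford (t_restr T x) n y})" (is "?L = ?R")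
    proof
      show "?L \<subseteq> ?R"
        using lab_le[OF T restr_nodes_sub] par_in_restr[OF T] by auto
      show "?R \<subseteq> ?L"
      proof
        fix z assume "z \<in> ?R"
        then obtain y j where z: "z = (y, j)" "y \<in> restr_nodes T x n" "j \<le> ford T (Suc n) y"
          by auto
        then obtain w where "w \<in> nodes T (Suc (Suc n))" "par T (Suc n) w = y" "lab T (Suc n) w = j"
          using node_ex[OF T restr_nodes_sub, of y x n j] by blast
        then show "z \<in> ?L"
          using z T by (auto simp: image_iff restr_nodes_iff_par intro!: bexI[of _ w])
      qed
    qed
  qed
  moreover have "cropped (t_restr T x)"
    unfolding cropped_def using T
    by (auto simp: par_in_restr cropped_iff restr_nodes_sub)
  ultimately show ?thesis
    unfolding tobjs_def by auto
qed

text \<open>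
  Induction on the degree, in the form of structural induction on the tree.
\<close>

lemma tobjs_induct [consumes 1, case_names restr]:
  assumes "T \<in> tobjs"
    and step: "\<And>T. T \<in> tobjs \<Longrightarrow>
      (\<And>x. \<not> t_trivial T \<Longrightarrow> x \<in> nodes T (Suc 0) \<Longrightarrow> P (t_restr T x)) \<Longrightarrow> P T"
  shows "P T"
  using assms(1)
proof (induction T rule: measure_induct_rule[of degree])
  case (less T)
  show ?case
    by (rule step) (use less in \<open>auto intro: degree_restr_less restr_in_tobjs\<close>)
qed

section \<open>The category \<open>t\<Delta>\<^sub>+\<close>\<close>

lemma t_homD:
  assumes "\<phi> \<in> t_hom B A"
  shows "x \<in> nodes A n \<Longrightarrow> tmap \<phi> n x \<in> nodes B n"
    and "x \<in> nodes A (Suc n) \<Longrightarrow> par B n (tmap \<phi> (Suc n) x) = tmap \<phi> n (par A n x)"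
    and "x \<in> nodes A n \<Longrightarrow> omap \<phi> n x \<in> ord_maps (ford B n (tmap \<phi> n x)) (ford A n x)"
    and "x \<in> nodes A (Suc n) \<Longrightarrow> lab B n (tmap \<phi> (Suc n) x) =
        wedge (ford B n (tmap \<phi> n (par A n x))) (omap \<phi> n (par A n x)) (lab A n x)"
    and "x \<notin> nodes A n \<Longrightarrow> tmap \<phi> n x = undefined"
    and "x \<notin> nodes A n \<Longrightarrow> omap \<phi> n x = undefined"
  using assms by (auto simp: t_hom_def is_tree_map_def extensional_def PiE_def Pi_iff)

lemma t_homI:
  assumes "\<And>n x. x \<in> nodes A n \<Longrightarrow> tmap \<phi> n x \<in> nodes B n"
    and "\<And>n x. x \<in> nodes A (Suc n) \<Longrightarrow> par B n (tmap \<phi> (Suc n) x) = tmap \<phi> n (par A n x)"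
    and "\<And>n x. x \<in> nodes A n \<Longrightarrow> omap \<phi> n x \<in> ord_maps (ford B n (tmap \<phi> n x)) (ford A n x)"
    and "\<And>n x. x \<in> nodes A (Suc n) \<Longrightarrow> lab B n (tmap \<phi> (Suc n) x) =
        wedge (ford B n (tmap \<phi> n (par A n x))) (omap \<phi> n (par A n x)) (lab A n x)"
    and "\<And>n x. x \<notin> nodes A n \<Longrightarrow> tmap \<phi> n x = undefined"
    and "\<And>n x. x \<notin> nodes A n \<Longrightarrow> omap \<phi> n x = undefined"
  shows "\<phi> \<in> t_hom B A"
  using assms by (auto simp: t_hom_def is_tree_map_def extensional_def PiE_def Pi_iff)

lemma t_hom_eqI:
  assumes "\<phi> \<in> t_hom B A" and "\<psi> \<in> t_hom B' A"
    and "\<And>n x. x \<in> nodes A n \<Longrightarrow> tmap \<phi> n x = tmap \<psi> n x"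
    and "\<And>n x. x \<in> nodes A n \<Longrightarrow> omap \<phi> n x = omap \<psi> n x"
  shows "\<phi> = \<psi>"
proof -
  have "tmap \<phi> n x = tmap \<psi> n x \<and> omap \<phi> n x = omap \<psi> n x" for n x
    using assms by (cases "x \<in> nodes A n") (simp_all add: t_homD)
  then have "tmap \<phi> = tmap \<psi>" and "omap \<phi> = omap \<psi>"
    by (auto simp: fun_eq_iff)
  then show ?thesis by simp
qed

lemma t_id_in: "A \<in> tobjs \<Longrightarrow> t_id A \<in> t_hom A A"
  by (rule t_homI) (auto simp: t_id_def par_in ord_maps_id wedge_id lab_le)

lemma t_comp_in:
  assumes "A \<in> tobjs" and "\<phi> \<in> t_hom B A" and "\<psi> \<in> t_hom C B"
  shows "t_comp C B A \<phi> \<psi> \<in> t_hom C A"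
proof (rule t_homI)
  fix n x assume "x \<in> nodes A (Suc n)"
  moreover from this have "par A n x \<in> nodes A n"
    by (rule par_in[OF assms(1)])
  ultimately show "lab C n (tmap (t_comp C B A \<phi> \<psi>) (Suc n) x) =
      wedge (ford C n (tmap (t_comp C B A \<phi> \<psi>) n (par A n x)))
        (omap (t_comp C B A \<phi> \<psi>) n (par A n x)) (lab A n x)"
    by (simp add: t_comp_def t_homD[OF assms(2)] t_homD[OF assms(3)]
        wedge_comp[OF t_homD(3)[OF assms(3)] t_homD(3)[OF assms(2)]])
next
  fix n x assume "x \<in> nodes A n"
  then show "omap (t_comp C B A \<phi> \<psi>) n x \<in>
      ord_maps (ford C n (tmap (t_comp C B A \<phi> \<psi>) n x)) (ford A n x)"
    using ord_maps_comp[OF t_homD(3)[OF assms(3)] t_homD(3)[OF assms(2)]] t_homD(1)[OF assms(2)]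
    by (simp add: t_comp_def)
qed (use assms(1) in \<open>simp_all add: t_comp_def par_in t_homD[OF assms(2)] t_homD[OF assms(3)]\<close>)

lemma ord_maps_undefined: "g \<in> ord_maps a b \<Longrightarrow> \<not> i < a \<Longrightarrow> g i = undefined"
  by (auto simp: ord_maps_def)

lemma t_comp_id_right:
  assumes "A \<in> tobjs" and "B \<in> tobjs" and "\<phi> \<in> t_hom B A"
  shows "t_comp B B A \<phi> (t_id B) = \<phi>"
proof (rule t_hom_eqI[OF t_comp_in[OF assms(1,3) t_id_in[OF assms(2)]] assms(3)])
  fix n x assume "x \<in> nodes A n"
  then show "tmap (t_comp B B A \<phi> (t_id B)) n x = tmap \<phi> n x"
    and "omap (t_comp B B A \<phi> (t_id B)) n x = omap \<phi> n x"
    using t_homD(3)[OF assms(3), THEN ord_maps_undefined] t_homD(1)[OF assms(3)]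
    by (auto simp: t_comp_def t_id_def fun_eq_iff)
qed

lemma t_comp_id_left:
  assumes "A \<in> tobjs" and "\<phi> \<in> t_hom B A"
  shows "t_comp B A A (t_id A) \<phi> = \<phi>"
proof (rule t_hom_eqI[OF t_comp_in[OF assms(1) t_id_in[OF assms(1)] assms(2)] assms(2)])
  fix n x assume x: "x \<in> nodes A n"
  then show "tmap (t_comp B A A (t_id A) \<phi>) n x = tmap \<phi> n x"
    by (simp add: t_comp_def t_id_def)
  show "omap (t_comp B A A (t_id A) \<phi>) n x = omap \<phi> n x"
    using t_homD(3)[OF assms(2) x, THEN ord_maps_undefined] x
      ord_maps_less[OF t_homD(3)[OF assms(2) x]]
    by (auto simp: t_comp_def t_id_def fun_eq_iff)
qed

lemma t_comp_assoc:
  assumes "A \<in> tobjs" "B \<in> tobjs"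
    and "\<phi> \<in> t_hom B A" and "\<psi> \<in> t_hom C B" and "\<chi> \<in> t_hom D C"
  shows "t_comp D B A \<phi> (t_comp D C B \<psi> \<chi>) = t_comp D C A (t_comp C B A \<phi> \<psi>) \<chi>"
proof (rule t_hom_eqI)
  show "t_comp D B A \<phi> (t_comp D C B \<psi> \<chi>) \<in> t_hom D A"
    using assms by (intro t_comp_in)
  show "t_comp D C A (t_comp C B A \<phi> \<psi>) \<chi> \<in> t_hom D A"
    using assms by (intro t_comp_in)
  fix n x assume x: "x \<in> nodes A n"
  then have "tmap \<phi> n x \<in> nodes B n"
    by (rule t_homD(1)[OF assms(3)])
  moreover from this have "tmap \<psi> n (tmap \<phi> n x) \<in> nodes C n"
    by (rule t_homD(1)[OF assms(4)])
  ultimately show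
    "tmap (t_comp D B A \<phi> (t_comp D C B \<psi> \<chi>)) n x = tmap (t_comp D C A (t_comp C B A \<phi> \<psi>) \<chi>) n x"
    "omap (t_comp D B A \<phi> (t_comp D C B \<psi> \<chi>)) n x = omap (t_comp D C A (t_comp C B A \<phi> \<psi>) \<chi>) n x"
    using x t_homD(3)[OF assms(5), THEN ord_maps_less] by (auto simp: t_comp_def fun_eq_iff)
qed

lemma is_category_tDelta: "is_category tDelta"
  unfolding is_category_def tDelta_def
  by (simp add: t_id_in t_comp_in t_comp_id_left t_comp_id_right t_comp_assoc)

section \<open>Restricting and gluing morphisms\<close>

lemma tmap_root: "A \<in> tobjs \<Longrightarrow> B \<in> tobjs \<Longrightarrow> \<phi> \<in> t_hom B A \<Longrightarrow> tmap \<phi> 0 (root A) = root B"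
  using t_homD(1)[of \<phi> B A "root A" 0] nodes_0 by fastforce

lemma omap_root:
  "A \<in> tobjs \<Longrightarrow> B \<in> tobjs \<Longrightarrow> \<phi> \<in> t_hom B A \<Longrightarrow>
   omap \<phi> 0 (root A) \<in> ord_maps (ford B 0 (root B)) (ford A 0 (root A))"
  using t_homD(3)[of \<phi> B A "root A" 0] nodes_0[of A] tmap_root[of A B \<phi>] by simp

text \<open>
  A child of the root is determined by its label, and the morphism condition prescribes the label of
  the image. Hence \<open>f\<^sub>1\<close> carries no information beyond \<open>\<alpha>\<^bsub>0,\<ast>\<^esub>\<close>.
\<close>

lemma tmap_child:
  assumes "A \<in> tobjs" and "B \<in> tobjs" and "\<phi> \<in> t_hom B A" and "j \<le> ford A 0 (root A)"
  shows "tmap \<phi> (Suc 0) (child A j) =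
    child B (wedge (ford B 0 (root B)) (omap \<phi> 0 (root A)) j)"
proof -
  have "tmap \<phi> (Suc 0) (child A j) \<in> nodes B (Suc 0)"
    using assms by (simp add: t_homD(1) child)
  moreover have "lab B 0 (tmap \<phi> (Suc 0) (child A j)) =
      wedge (ford B 0 (root B)) (omap \<phi> 0 (root A)) j"
    using assms by (simp add: t_homD(4) child par_0 tmap_root)
  ultimately show ?thesis
    using child_lab[OF assms(2)] by metis
qed

lemma not_trivial_codomain:
  assumes "A \<in> tobjs" and "B \<in> tobjs" and "\<phi> \<in> t_hom B A" and "\<not> t_trivial B"
  shows "\<not> t_trivial A"
proof
  assume "t_trivial A"
  then have "omap \<phi> 0 (root A) \<in> ord_maps (ford B 0 (root B)) 0"
    using omap_root[OF assms(1-3)] assms(1) by (simp add: trivial_iff)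
  then have "ford B 0 (root B) = 0"
    by (rule ord_maps_to_0)
  then show False
    using assms(2,4) by (simp add: trivial_iff)
qed

lemma tmap_restr_nodes:
  assumes "A \<in> tobjs" and "B \<in> tobjs" and "\<phi> \<in> t_hom B A"
  shows "y \<in> restr_nodes A x m \<Longrightarrow> tmap \<phi> (Suc m) y \<in> restr_nodes B (tmap \<phi> (Suc 0) x) m"
proof (induction m arbitrary: y)
  case 0
  then show ?case
    using t_homD(1)[OF assms(3)] by (auto simp: restr_nodes_def)
next
  case (Suc m)
  have "y \<in> nodes A (Suc (Suc m))"
    using Suc.prems by (rule restr_nodes_sub)
  moreover have "tmap \<phi> (Suc m) (par A (Suc m) y) \<in> restr_nodes B (tmap \<phi> (Suc 0) x) m"
    using Suc.IH par_in_restr[OF assms(1) Suc.prems] .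
  ultimately show ?case
    by (simp add: restr_nodes_iff_par[OF assms(2)] t_homD[OF assms(3)])
qed

lemma t_restr_mor_simps [simp]:
  "y \<in> restr_nodes A x m \<Longrightarrow> tmap (t_restr_mor A x \<phi>) m y = tmap \<phi> (Suc m) y"
  "y \<in> restr_nodes A x m \<Longrightarrow> omap (t_restr_mor A x \<phi>) m y = omap \<phi> (Suc m) y"
  "y \<notin> restr_nodes A x m \<Longrightarrow> tmap (t_restr_mor A x \<phi>) m y = undefined"
  "y \<notin> restr_nodes A x m \<Longrightarrow> omap (t_restr_mor A x \<phi>) m y = undefined"
  by (simp_all add: t_restr_mor_def)

lemma t_restr_mor_in:
  assumes "A \<in> tobjs" and "B \<in> tobjs" and "\<phi> \<in> t_hom B A"
  shows "t_restr_mor A x \<phi> \<in> t_hom (t_restr B (tmap \<phi> (Suc 0) x)) (t_restr A x)"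
  by (rule t_homI)
    (simp_all add: tmap_restr_nodes[OF assms] par_in_restr[OF assms(1)] restr_nodes_sub
      t_homD[OF assms(3)])

lemma t_restr_mor_id:
  assumes "A \<in> tobjs" and "\<not> t_trivial A" and "x \<in> nodes A (Suc 0)"
  shows "t_restr_mor A x (t_id A) = t_id (t_restr A x)"
proof (rule t_hom_eqI)
  show "t_restr_mor A x (t_id A) \<in> t_hom (t_restr A (tmap (t_id A) (Suc 0) x)) (t_restr A x)"
    using assms by (simp add: t_restr_mor_in t_id_in)
  show "t_id (t_restr A x) \<in> t_hom (t_restr A x) (t_restr A x)"
    using assms by (simp add: restr_in_tobjs t_id_in)
qed (simp_all add: t_id_def restr_nodes_sub)

lemma t_restr_mor_comp:
  assumes A: "A \<in> tobjs" and B: "B \<in> tobjs" and C: "C \<in> tobjs"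
    and \<phi>: "\<phi> \<in> t_hom B A" and \<psi>: "\<psi> \<in> t_hom C B"
    and nontriv: "\<not> t_trivial A" and x: "x \<in> nodes A (Suc 0)"
  shows "t_restr_mor A x (t_comp C B A \<phi> \<psi>) =
    t_comp (t_restr C (tmap \<psi> (Suc 0) (tmap \<phi> (Suc 0) x))) (t_restr B (tmap \<phi> (Suc 0) x))
      (t_restr A x) (t_restr_mor A x \<phi>) (t_restr_mor B (tmap \<phi> (Suc 0) x) \<psi>)"
proof (rule t_hom_eqI)
  show "t_restr_mor A x (t_comp C B A \<phi> \<psi>) \<in>
      t_hom (t_restr C (tmap (t_comp C B A \<phi> \<psi>) (Suc 0) x)) (t_restr A x)"
    by (rule t_restr_mor_in[OF A C t_comp_in[OF A \<phi> \<psi>]])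
  show "t_comp (t_restr C (tmap \<psi> (Suc 0) (tmap \<phi> (Suc 0) x))) (t_restr B (tmap \<phi> (Suc 0) x))
      (t_restr A x) (t_restr_mor A x \<phi>) (t_restr_mor B (tmap \<phi> (Suc 0) x) \<psi>)
      \<in> t_hom (t_restr C (tmap \<psi> (Suc 0) (tmap \<phi> (Suc 0) x))) (t_restr A x)"
    using restr_in_tobjs[OF A nontriv x] t_restr_mor_in[OF A B \<phi>] t_restr_mor_in[OF B C \<psi>]
    by (rule t_comp_in)
qed (simp_all add: t_comp_def restr_nodes_sub tmap_restr_nodes[OF A B \<phi>]
    tmap_restr_nodes[OF B C \<psi>])

text \<open>
  Every node is the root or lies in the restriction to some child of the root.
\<close>

lemma t_hom_eqI_restr:
  assumes A: "A \<in> tobjs" and B: "B \<in> tobjs" and \<phi>: "\<phi> \<in> t_hom B A" and \<psi>: "\<psi> \<in> t_hom B A"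
    and root: "omap \<phi> 0 (root A) = omap \<psi> 0 (root A)"
    and restr: "\<And>j. j \<le> ford A 0 (root A) \<Longrightarrow>
      t_restr_mor A (child A j) \<phi> = t_restr_mor A (child A j) \<psi>"
  shows "\<phi> = \<psi>"
proof (rule t_hom_eqI[OF \<phi> \<psi>])
  fix n x assume x: "x \<in> nodes A n"
  have "tmap \<phi> n x = tmap \<psi> n x \<and> omap \<phi> n x = omap \<psi> n x"
  proof (cases n)
    case 0
    then show ?thesis
      using x A B \<phi> \<psi> root by (simp add: nodes_0 tmap_root)
  next
    case (Suc m)
    then obtain j where "j \<le> ford A 0 (root A)" and "x \<in> restr_nodes A (child A j) m"
      using in_restr_nodes[OF A] x by blast
    then show ?thesis
      using restr[of j] t_restr_mor_simps(1,2) Suc by metis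
  qed
  then show "tmap \<phi> n x = tmap \<psi> n x" and "omap \<phi> n x = omap \<psi> n x"
    by simp_all
qed

text \<open>
  The converse of restriction: a root map and morphisms between the restrictions combine to a morphism.
  The conditions that link a node to its parent hold inside each \<open>A(x)\<close> since they hold for the given
  morphism \<open>\<psi> j\<close>. The only link that crosses a boundary is the one from a child of the root to the
  root, and there the domain of \<open>\<psi> j\<close> has been chosen to have the prescribed label.
\<close>

lemma t_hom_glue:
  assumes A: "A \<in> tobjs" and B: "B \<in> tobjs"
    and g: "g \<in> ord_maps (ford B 0 (root B)) (ford A 0 (root A))"
    and \<psi>: "\<And>j. j \<le> ford A 0 (root A) \<Longrightarrow>
      \<psi> j \<in> t_hom (t_restr B (child B (wedge (ford B 0 (root B)) g j))) (t_restr A (child A j))"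
  obtains \<phi> where "\<phi> \<in> t_hom B A" and "omap \<phi> 0 (root A) = g"
    and "\<And>j. j \<le> ford A 0 (root A) \<Longrightarrow> t_restr_mor A (child A j) \<phi> = \<psi> j"
proof -
  define w where "w j = wedge (ford B 0 (root B)) g j" for j
  note \<psi> = \<psi>[folded w_def]
  have w: "child B (w j) \<in> nodes B (Suc 0)" "lab B 0 (child B (w j)) = w j" for j
    using child[OF B] wedge_le by (auto simp: w_def)
  \<comment> \<open>the label of the child of the root below which the node \<open>y\<close> lies\<close>
  define br where "br m y = lab A 0 (par_comp A 1 m y)" for m y
  define \<phi> where "\<phi> = \<lparr>
    tmap = case_nat (\<lambda>y \<in> nodes A 0. root B) (\<lambda>m. \<lambda>y \<in> nodes A (Suc m). tmap (\<psi> (br m y)) m y),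
    omap = case_nat (\<lambda>y \<in> nodes A 0. g) (\<lambda>m. \<lambda>y \<in> nodes A (Suc m). omap (\<psi> (br m y)) m y)\<rparr>"
  have \<phi>_0: "tmap \<phi> 0 (root A) = root B" "omap \<phi> 0 (root A) = g"
    using nodes_0[OF A] by (simp_all add: \<phi>_def)
  have \<phi>_Suc: "tmap \<phi> (Suc m) y = tmap (\<psi> j) m y" "omap \<phi> (Suc m) y = omap (\<psi> j) m y"
    if "j \<le> ford A 0 (root A)" "y \<in> restr_nodes A (child A j) m" for j m y
  proof -
    have "br m y = j"
      using that child(2)[OF A] by (simp add: br_def restr_nodes_def)
    then show "tmap \<phi> (Suc m) y = tmap (\<psi> j) m y" "omap \<phi> (Suc m) y = omap (\<psi> j) m y"
      using that by (simp_all add: \<phi>_def restr_nodes_sub)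
  qed
  have tmap_0: "tmap (\<psi> j) 0 (child A j) = child B (w j)" if "j \<le> ford A 0 (root A)" for j
    using t_homD(1)[OF \<psi>[OF that], of "child A j" 0] child[OF A that] w
    by (simp add: restr_nodes_0)
  have tmap_in: "tmap (\<psi> j) m y \<in> restr_nodes B (child B (w j)) m"
    if "j \<le> ford A 0 (root A)" "y \<in> restr_nodes A (child A j) m" for j m y
    using t_homD(1)[OF \<psi>[OF that(1)], of y m] that by simp
  have in_hom: "\<phi> \<in> t_hom B A"
  proof (rule t_homI)
    fix n x assume x: "x \<in> nodes A n"
    have "tmap \<phi> n x \<in> nodes B n \<and> omap \<phi> n x \<in> ord_maps (ford B n (tmap \<phi> n x)) (ford A n x)"
    proof (cases n)
      case 0
      then show ?thesis
        using x nodes_0[OF A] nodes_0[OF B] \<phi>_0 g by simp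
    next
      case (Suc m)
      then obtain j where j: "j \<le> ford A 0 (root A)" "x \<in> restr_nodes A (child A j) m"
        using in_restr_nodes[OF A] x by blast
      then show ?thesis
        using t_homD(3)[OF \<psi>[OF j(1)], of x m] tmap_in[OF j] Suc
        by (simp add: \<phi>_Suc restr_nodes_sub)
    qed
    then show "tmap \<phi> n x \<in> nodes B n"
      and "omap \<phi> n x \<in> ord_maps (ford B n (tmap \<phi> n x)) (ford A n x)"
      by simp_all
  next
    fix n x assume x: "x \<in> nodes A (Suc n)"
    obtain j where j: "j \<le> ford A 0 (root A)" "x \<in> restr_nodes A (child A j) n"
      by (rule in_restr_nodes[OF A x])
    have "par B n (tmap \<phi> (Suc n) x) = tmap \<phi> n (par A n x) \<and>
      lab B n (tmap \<phi> (Suc n) x) =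
        wedge (ford B n (tmap \<phi> n (par A n x))) (omap \<phi> n (par A n x)) (lab A n x)"
    proof (cases n)
      case 0
      then have "x = child A j"
        using j child[OF A] by (simp add: restr_nodes_0)
      then show ?thesis
        using 0 j child[OF A] w by (simp add: \<phi>_Suc[OF j(1)] tmap_0 par_0[OF A] par_0[OF B] \<phi>_0 w_def)
    next
      case (Suc m)
      have j': "x \<in> restr_nodes A (child A j) (Suc m)"
        "par A (Suc m) x \<in> restr_nodes A (child A j) m"
        using j Suc par_in_restr[OF A] by auto
      show ?thesis
        using t_homD(2,4)[OF \<psi>[OF j(1)], of x m] j' Suc tmap_in[OF j(1) j'(1)]
          tmap_in[OF j(1) j'(2)]
        by (simp add: \<phi>_Suc[OF j(1) j'(1)] \<phi>_Suc[OF j(1) j'(2)])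
    qed
    then show "par B n (tmap \<phi> (Suc n) x) = tmap \<phi> n (par A n x)"
      and "lab B n (tmap \<phi> (Suc n) x) =
        wedge (ford B n (tmap \<phi> n (par A n x))) (omap \<phi> n (par A n x)) (lab A n x)"
      by simp_all
  qed (auto simp: \<phi>_def split: nat.split)
  moreover have "t_restr_mor A (child A j) \<phi> = \<psi> j" if "j \<le> ford A 0 (root A)" for j
    by (rule t_hom_eqI[OF t_restr_mor_in[OF A B in_hom] \<psi>[OF that]])
      (simp_all add: \<phi>_Suc[OF that])
  ultimately show ?thesis
    using that \<phi>_0 by blast
qed

text \<open>
  All sets of a trivial tree are singletons and all its ordinals are empty, so there is exactly one
  candidate for every component; the condition on labels holds since \<open>0\<close> is the only label.
\<close>

lemma ex1_t_hom_from_trivial: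
  assumes A: "A \<in> tobjs" and B: "B \<in> tobjs" and "t_trivial B"
  shows "\<exists>!\<phi>. \<phi> \<in> t_hom B A"
proof -
  obtain b where b: "\<And>n. nodes B n = {b n}" "\<And>n. ford B n (b n) = 0"
    using nodes_if_ford_root_0[OF B] assms(3) trivial_iff[OF B] by metis
  have b_Suc: "par B n (b (Suc n)) = b n" "lab B n (b (Suc n)) = 0" for n
    using par_in[OF B, of "b (Suc n)" n] lab_le[OF B, of "b (Suc n)" n] b by simp_all
  have wedge_0: "wedge 0 h j = 0" for h j
    using wedge_le[of 0] by simp
  define \<phi> where "\<phi> = \<lparr>tmap = (\<lambda>n. \<lambda>x \<in> nodes A n. b n), omap = (\<lambda>n. \<lambda>x \<in> nodes A n. \<lambda>i. undefined)\<rparr>"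
  have "\<phi> \<in> t_hom B A"
    by (rule t_homI)
      (simp_all add: \<phi>_def b b_Suc par_in[OF A] ord_maps_0 wedge_0)
  moreover have "\<phi>\<^sub>1 = \<phi>\<^sub>2" if 1: "\<phi>\<^sub>1 \<in> t_hom B A" and 2: "\<phi>\<^sub>2 \<in> t_hom B A" for \<phi>\<^sub>1 \<phi>\<^sub>2
  proof (rule t_hom_eqI[OF 1 2])
    fix n x assume x: "x \<in> nodes A n"
    show "tmap \<phi>\<^sub>1 n x = tmap \<phi>\<^sub>2 n x"
      using t_homD(1)[OF 1 x] t_homD(1)[OF 2 x] b by simp
    show "omap \<phi>\<^sub>1 n x = omap \<phi>\<^sub>2 n x"
      using t_homD(1,3)[OF 1 x] t_homD(1,3)[OF 2 x] b by (simp add: ord_maps_0)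
  qed
  ultimately show ?thesis by blast
qed

section \<open>The functor \<open>\<Xi>\<^sub>\<Delta>\<close> is fully faithful\<close>

lemma Xi_ob_trivial: "T \<in> tobjs \<Longrightarrow> t_trivial T \<Longrightarrow> Xi_ob T = ITriv"
  by (simp add: Xi_ob.simps)

lemma Xi_ob_node:
  "T \<in> tobjs \<Longrightarrow> \<not> t_trivial T \<Longrightarrow> Xi_ob T = INode (ford T 0 (root T))
     (\<lambda>j \<in> {..ford T 0 (root T)}. Xi_ob (t_restr T (child T j)))"
  by (subst Xi_ob.simps) simp

lemma Xi_ob_eq_ITriv_iff: "T \<in> tobjs \<Longrightarrow> Xi_ob T = ITriv \<longleftrightarrow> t_trivial T"
  by (cases "t_trivial T") (simp_all add: Xi_ob_trivial Xi_ob_node)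

lemma Xi_mor_trivial: "B \<in> tobjs \<Longrightarrow> t_trivial B \<Longrightarrow> Xi_mor B A \<phi> = IInit"
  by (simp add: Xi_mor.simps)

lemma Xi_mor_map:
  "B \<in> tobjs \<Longrightarrow> \<not> t_trivial B \<Longrightarrow> Xi_mor B A \<phi> = IMap (omap \<phi> 0 (root A))
     (\<lambda>j \<in> {..ford A 0 (root A)}. Xi_mor (t_restr B (tmap \<phi> (Suc 0) (child A j)))
        (t_restr A (child A j)) (t_restr_mor A (child A j) \<phi>))"
  by (subst Xi_mor.simps) simp

text \<open>
  Cropping is the condition that a fibre \<open>K(j)\<close> is trivial if and only if \<open>j\<close> is an endpoint.
\<close>

lemma Xi_ob_in: "T \<in> tobjs \<Longrightarrow> Xi_ob T \<in> iobjs"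
proof (induction T rule: tobjs_induct)
  case (restr T)
  note T = restr.hyps
  show ?case
  proof (cases "t_trivial T")
    case True
    then show ?thesis
      using T by (auto simp: Xi_ob_trivial iobjs_def intro: height_triv)
  next
    case False
    have "Xi_ob (t_restr T (child T j)) = ITriv \<longleftrightarrow> wedge_endpoint (ford T 0 (root T)) j"
      if "j \<le> ford T 0 (root T)" for j
    proof -
      have "Xi_ob (t_restr T (child T j)) = ITriv \<longleftrightarrow> ford T (Suc 0) (child T j) = 0"
        using child[OF T that]
        by (simp add: Xi_ob_eq_ITriv_iff trivial_iff restr_in_tobjs[OF T False] restr_nodes_0)
      also have "\<dots> \<longleftrightarrow> wedge_endpoint (ford T 0 (root T)) j"
        using cropped_iff[OF T, of "child T j" 0] child[OF T that] par_0[OF T] by simp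
      finally show ?thesis .
    qed
    moreover have "0 < ford T 0 (root T)"
      using False trivial_iff[OF T] by simp
    ultimately show ?thesis
      using restr.IH[OF False] child[OF T] by (auto simp: Xi_ob_node T False intro: iobjs_nodeI)
  qed
qed

lemma Xi_mor_in:
  "B \<in> tobjs \<Longrightarrow> A \<in> tobjs \<Longrightarrow> \<phi> \<in> t_hom B A \<Longrightarrow> is_imor (Xi_ob B) (Xi_ob A) (Xi_mor B A \<phi>)"
proof (induction B arbitrary: A \<phi> rule: tobjs_induct)
  case (restr B)
  note B = restr.hyps and A = restr.prems(1) and \<phi> = restr.prems(2)
  show ?case
  proof (cases "t_trivial B")
    case True
    then show ?thesis
      using B by (simp add: Xi_ob_trivial Xi_mor_trivial imor_init)
  next
    case False
    note A' = not_trivial_codomain[OF A B \<phi> False]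
    have "is_imor (Xi_ob (t_restr B (tmap \<phi> (Suc 0) (child A j))))
        (Xi_ob (t_restr A (child A j)))
        (Xi_mor (t_restr B (tmap \<phi> (Suc 0) (child A j))) (t_restr A (child A j))
          (t_restr_mor A (child A j) \<phi>))"
      if "j \<le> ford A 0 (root A)" for j
      using child[OF A that] t_homD(1)[OF \<phi>]
      by (intro restr.IH[OF False] restr_in_tobjs[OF A A'] t_restr_mor_in[OF A B \<phi>]) auto
    then show ?thesis
      using omap_root[OF A B \<phi>]
      by (auto simp: Xi_ob_node Xi_mor_map B A A' False tmap_child[OF A B \<phi>] wedge_le
          intro!: imor_map)
  qed
qed

lemma Xi_mor_id: "A \<in> tobjs \<Longrightarrow> Xi_mor A A (t_id A) = i_id (Xi_ob A)"
proof (induction A rule: tobjs_induct)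
  case (restr A)
  note A = restr.hyps
  show ?case
  proof (cases "t_trivial A")
    case True
    then show ?thesis
      using A by (simp add: Xi_ob_trivial Xi_mor_trivial)
  next
    case False
    then show ?thesis
      using restr.IH[OF False] A child[OF A] nodes_0[OF A]
      by (simp add: Xi_ob_node Xi_mor_map t_restr_mor_id fun_eq_iff)
        (simp add: t_id_def)
  qed
qed

lemma Xi_mor_comp:
  "C \<in> tobjs \<Longrightarrow> B \<in> tobjs \<Longrightarrow> A \<in> tobjs \<Longrightarrow> \<phi> \<in> t_hom B A \<Longrightarrow> \<psi> \<in> t_hom C B \<Longrightarrow>
   Xi_mor C A (t_comp C B A \<phi> \<psi>) =
     i_comp (Xi_mor B A \<phi>) (Xi_ob C) (Xi_ob B) (Xi_ob A) (Xi_mor C B \<psi>)"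
proof (induction C arbitrary: A B \<phi> \<psi> rule: tobjs_induct)
  case (restr C)
  note C = restr.hyps and B = restr.prems(1) and A = restr.prems(2)
    and \<phi> = restr.prems(3) and \<psi> = restr.prems(4)
  show ?case
  proof (cases "t_trivial C")
    case True
    then show ?thesis
      using C by (cases "Xi_mor B A \<phi>") (simp_all add: Xi_mor_trivial)
  next
    case False
    note B' = not_trivial_codomain[OF B C \<psi> False]
    note A' = not_trivial_codomain[OF A B \<phi> B']
    let ?a = "ford A 0 (root A)" and ?b = "ford B 0 (root B)" and ?c = "ford C 0 (root C)"
    let ?g = "omap \<phi> 0 (root A)" and ?h = "omap \<psi> 0 (root B)"
    have root: "omap (t_comp C B A \<phi> \<psi>) 0 (root A) = (\<lambda>i \<in> {..<?c}. ?g (?h i))"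
      using nodes_0[OF A] by (simp add: t_comp_def tmap_root[OF A B \<phi>] tmap_root[OF B C \<psi>])
    have step: "Xi_mor (t_restr C (tmap (t_comp C B A \<phi> \<psi>) (Suc 0) (child A j)))
          (t_restr A (child A j)) (t_restr_mor A (child A j) (t_comp C B A \<phi> \<psi>)) =
        i_comp
          (Xi_mor (t_restr B (tmap \<phi> (Suc 0) (child A j))) (t_restr A (child A j))
            (t_restr_mor A (child A j) \<phi>))
          (Xi_ob (t_restr C (child C (wedge ?c ?h (wedge ?b ?g j)))))
          (Xi_ob (t_restr B (child B (wedge ?b ?g j))))
          (Xi_ob (t_restr A (child A j)))
          (Xi_mor (t_restr C (tmap \<psi> (Suc 0) (child B (wedge ?b ?g j))))
            (t_restr B (child B (wedge ?b ?g j)))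
            (t_restr_mor B (child B (wedge ?b ?g j)) \<psi>))"
      if j: "j \<le> ?a" for j
    proof -
      have x: "child A j \<in> nodes A (Suc 0)"
        using child[OF A j] by simp
      have \<phi>x: "tmap \<phi> (Suc 0) (child A j) = child B (wedge ?b ?g j)"
        by (rule tmap_child[OF A B \<phi> j])
      have \<psi>x: "tmap \<psi> (Suc 0) (child B (wedge ?b ?g j)) = child C (wedge ?c ?h (wedge ?b ?g j))"
        by (rule tmap_child[OF B C \<psi> wedge_le])
      have tx: "tmap (t_comp C B A \<phi> \<psi>) (Suc 0) (child A j) =
          child C (wedge ?c ?h (wedge ?b ?g j))"
        using x \<phi>x \<psi>x by (simp add: t_comp_def)
      show ?thesis
        unfolding t_restr_mor_comp[OF A B C \<phi> \<psi> A' x] tx \<phi>x \<psi>x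
      proof (rule restr.IH[OF False])
        show "child C (wedge ?c ?h (wedge ?b ?g j)) \<in> nodes C (Suc 0)"
          by (rule child(1)[OF C wedge_le])
        show "t_restr B (child B (wedge ?b ?g j)) \<in> tobjs"
          by (rule restr_in_tobjs[OF B B' child(1)[OF B wedge_le]])
        show "t_restr A (child A j) \<in> tobjs"
          by (rule restr_in_tobjs[OF A A' x])
        show "t_restr_mor A (child A j) \<phi> \<in>
            t_hom (t_restr B (child B (wedge ?b ?g j))) (t_restr A (child A j))"
          using t_restr_mor_in[OF A B \<phi>, of "child A j"] by (simp add: \<phi>x)
        show "t_restr_mor B (child B (wedge ?b ?g j)) \<psi> \<in>
            t_hom (t_restr C (child C (wedge ?c ?h (wedge ?b ?g j))))
              (t_restr B (child B (wedge ?b ?g j)))"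
          using t_restr_mor_in[OF B C \<psi>, of "child B (wedge ?b ?g j)"] by (simp add: \<psi>x)
      qed
    qed
    show ?thesis
      by (simp add: Xi_mor_map[OF C False] Xi_mor_map[OF B B'] Xi_ob_node[OF C False]
          Xi_ob_node[OF B B'] Xi_ob_node[OF A A'] root step wedge_le cong: restrict_cong)
  qed
qed

text \<open>
  Equal images have equal root maps. By \<open>tmap_child\<close> the restrictions of the two morphisms to a child
  then have the same domain, so the induction hypothesis applies to them.
\<close>

lemma Xi_mor_inj:
  "B \<in> tobjs \<Longrightarrow> A \<in> tobjs \<Longrightarrow> \<phi> \<in> t_hom B A \<Longrightarrow> \<psi> \<in> t_hom B A \<Longrightarrow>
   Xi_mor B A \<phi> = Xi_mor B A \<psi> \<Longrightarrow> \<phi> = \<psi>"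
proof (induction B arbitrary: A \<phi> \<psi> rule: tobjs_induct)
  case (restr B)
  note B = restr.hyps and A = restr.prems(1) and \<phi> = restr.prems(2) and \<psi> = restr.prems(3)
  show ?case
  proof (cases "t_trivial B")
    case True
    then show ?thesis
      using ex1_t_hom_from_trivial[OF A B] \<phi> \<psi> by blast
  next
    case False
    note A' = not_trivial_codomain[OF A B \<phi> False]
    have root: "omap \<phi> 0 (root A) = omap \<psi> 0 (root A)"
      using restr.prems(4) by (simp add: Xi_mor_map[OF B False])
    show ?thesis
    proof (rule t_hom_eqI_restr[OF A B \<phi> \<psi> root])
      fix j assume j: "j \<le> ford A 0 (root A)"
      let ?x = "child A j"
      have x: "?x \<in> nodes A (Suc 0)"
        using child[OF A j] by simp
      have same: "tmap \<psi> (Suc 0) ?x = tmap \<phi> (Suc 0) ?x"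
        by (simp add: tmap_child[OF A B _ j] \<phi> \<psi> root)
      show "t_restr_mor A ?x \<phi> = t_restr_mor A ?x \<psi>"
      proof (rule restr.IH[OF False])
        show "tmap \<phi> (Suc 0) ?x \<in> nodes B (Suc 0)"
          by (rule t_homD(1)[OF \<phi> x])
        show "t_restr A ?x \<in> tobjs"
          by (rule restr_in_tobjs[OF A A' x])
        show "t_restr_mor A ?x \<phi> \<in> t_hom (t_restr B (tmap \<phi> (Suc 0) ?x)) (t_restr A ?x)"
          by (rule t_restr_mor_in[OF A B \<phi>])
        show "t_restr_mor A ?x \<psi> \<in> t_hom (t_restr B (tmap \<phi> (Suc 0) ?x)) (t_restr A ?x)"
          using t_restr_mor_in[OF A B \<psi>, of ?x] by (simp add: same)
        have "(\<lambda>j \<in> {..ford A 0 (root A)}. Xi_mor (t_restr B (tmap \<phi> (Suc 0) (child A j)))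
              (t_restr A (child A j)) (t_restr_mor A (child A j) \<phi>)) =
            (\<lambda>j \<in> {..ford A 0 (root A)}. Xi_mor (t_restr B (tmap \<psi> (Suc 0) (child A j)))
              (t_restr A (child A j)) (t_restr_mor A (child A j) \<psi>))"
          using restr.prems(4) unfolding Xi_mor_map[OF B False] imor.inject by (rule conjunct2)
        from fun_cong[OF this, of j]
        show "Xi_mor (t_restr B (tmap \<phi> (Suc 0) ?x)) (t_restr A ?x) (t_restr_mor A ?x \<phi>) =
            Xi_mor (t_restr B (tmap \<phi> (Suc 0) ?x)) (t_restr A ?x) (t_restr_mor A ?x \<psi>)"
          using j by (simp add: same)
      qed
    qed
  qed
qed

text \<open>
  The components of the given morphism lift by the induction hypothesis, and the lifts are glued.
\<close>

lemma Xi_mor_surj: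
  "B \<in> tobjs \<Longrightarrow> A \<in> tobjs \<Longrightarrow> is_imor (Xi_ob B) (Xi_ob A) h \<Longrightarrow>
   \<exists>\<phi> \<in> t_hom B A. Xi_mor B A \<phi> = h"
proof (induction B arbitrary: A h rule: tobjs_induct)
  case (restr B)
  note B = restr.hyps and A = restr.prems(1) and h = restr.prems(2)
  show ?case
  proof (cases "t_trivial B")
    case True
    obtain \<phi> where "\<phi> \<in> t_hom B A"
      using ex1_t_hom_from_trivial[OF A B True] by blast
    moreover have "h = IInit"
      using h by (cases rule: is_imor.cases) (simp_all add: Xi_ob_trivial[OF B True])
    ultimately show ?thesis
      using Xi_mor_trivial[OF B True] by blast
  next
    case False
    let ?a = "ford A 0 (root A)" and ?b = "ford B 0 (root B)"
    have A': "\<not> t_trivial A"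
    proof
      assume "t_trivial A"
      with h show False
        by (cases rule: is_imor.cases) (simp_all add: Xi_ob_trivial[OF A] Xi_ob_node[OF B False])
    qed
    from h obtain g \<gamma> where h_eq: "h = IMap g \<gamma>"
      and g: "g \<in> ord_maps ?b ?a" and ext: "\<gamma> \<in> extensional {..?a}"
      and \<gamma>: "\<And>j. j \<le> ?a \<Longrightarrow>
        is_imor (Xi_ob (t_restr B (child B (wedge ?b g j)))) (Xi_ob (t_restr A (child A j))) (\<gamma> j)"
      by (cases rule: is_imor.cases)
        (auto simp: Xi_ob_node[OF B False] Xi_ob_node[OF A A'] wedge_le)
    have "\<exists>\<psi> \<in> t_hom (t_restr B (child B (wedge ?b g j))) (t_restr A (child A j)).
        Xi_mor (t_restr B (child B (wedge ?b g j))) (t_restr A (child A j)) \<psi> = \<gamma> j"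
      if "j \<le> ?a" for j
      by (rule restr.IH[OF False child(1)[OF B wedge_le]
            restr_in_tobjs[OF A A' child(1)[OF A that]] \<gamma>[OF that]])
    then obtain \<psi> where \<psi>:
      "\<And>j. j \<le> ?a \<Longrightarrow> \<psi> j \<in> t_hom (t_restr B (child B (wedge ?b g j))) (t_restr A (child A j))"
      "\<And>j. j \<le> ?a \<Longrightarrow>
        Xi_mor (t_restr B (child B (wedge ?b g j))) (t_restr A (child A j)) (\<psi> j) = \<gamma> j"
      by metis
    obtain \<phi> where \<phi>: "\<phi> \<in> t_hom B A" "omap \<phi> 0 (root A) = g"
      "\<And>j. j \<le> ?a \<Longrightarrow> t_restr_mor A (child A j) \<phi> = \<psi> j"
      using t_hom_glue[OF A B g \<psi>(1)] by blast
    have "Xi_mor B A \<phi> = IMap g (\<lambda>j \<in> {..?a}. \<gamma> j)"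
      by (simp add: Xi_mor_map[OF B False] tmap_child[OF A B \<phi>(1)] \<phi>(2,3) \<psi>(2)
          cong: restrict_cong)
    also have "\<dots> = h"
      using ext by (simp add: h_eq extensional_restrict)
    finally show ?thesis
      using \<phi>(1) by blast
  qed
qed

lemma is_functor_Xi: "is_functor tDelta iDelta Xi_Delta"
  unfolding is_functor_def tDelta_def iDelta_def Xi_Delta_def
  by (simp add: Xi_ob_in Xi_mor_in Xi_mor_id Xi_mor_comp)

lemma Xi_fully_faithful:
  assumes "B \<in> tobjs" and "A \<in> tobjs"
  shows "bij_betw (Xi_mor B A) (t_hom B A) {g. is_imor (Xi_ob B) (Xi_ob A) g}"
proof (rule bij_betw_imageI)
  show "inj_on (Xi_mor B A) (t_hom B A)"
    using Xi_mor_inj[OF assms] by (auto intro: inj_onI)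
  show "Xi_mor B A ` t_hom B A = {g. is_imor (Xi_ob B) (Xi_ob A) g}"
    using Xi_mor_in[OF assms] Xi_mor_surj[OF assms] by blast
qed

section \<open>The functor \<open>\<Xi>\<^sub>\<Delta>\<close> is surjective on objects\<close>

text \<open>
  The object reached from \<open>K\<close> along a list of indices of fibres. The sets of a tree are nonempty at
  every level, so a path must go on for ever: a trivial object has itself as its only fibre, with index
  \<open>0\<close>, since the trivial object has \<open>iord ITriv = 0\<close>.
\<close>

primrec isub :: "iobj \<Rightarrow> nat list \<Rightarrow> iobj" where
  "isub K [] = K"
| "isub K (j # p) = (case K of ITriv \<Rightarrow> isub ITriv p | INode a L \<Rightarrow> isub (L j) p)"

primrec ipath :: "iobj \<Rightarrow> nat list \<Rightarrow> bool" where
  "ipath K [] \<longleftrightarrow> True"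
| "ipath K (j # p) \<longleftrightarrow>
     j \<le> iord K \<and> (case K of ITriv \<Rightarrow> ipath ITriv p | INode a L \<Rightarrow> ipath (L j) p)"

text \<open>
  The nodes of level \<open>n\<close> are the paths of length \<open>n\<close>, and the parent of a path drops its last index,
  which is its label. The parameter \<open>e\<close> encodes paths as elements of \<open>'a\<close>. With the encoding as a
  parameter, the restriction to the child with label \<open>j\<close> is again a path tree, for the encoding
  \<open>e \<circ> Cons j\<close>, and not just isomorphic to one (\<open>t_restr_path_tree\<close>).
\<close>

definition path_tree :: "(nat list \<Rightarrow> 'a) \<Rightarrow> iobj \<Rightarrow> 'a tobj" where
  "path_tree e K =
    \<lparr>nodes = (\<lambda>n. e ` {p. ipath K p \<and> length p = n}),
     par = (\<lambda>n. \<lambda>x \<in> e ` {p. ipath K p \<and> length p = Suc n}. e (butlast (inv e x))),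
     ford = (\<lambda>n. \<lambda>x \<in> e ` {p. ipath K p \<and> length p = n}. iord (isub K (inv e x))),
     lab = (\<lambda>n. \<lambda>x \<in> e ` {p. ipath K p \<and> length p = Suc n}. last (inv e x))\<rparr>"

lemma isub_ITriv [simp]: "isub ITriv p = ITriv"
  by (induction p) simp_all

lemma isub_append: "isub K (p @ q) = isub (isub K p) q"
  by (induction p arbitrary: K) (simp_all split: iobj.split)

lemma ipath_append: "ipath K (p @ q) \<longleftrightarrow> ipath K p \<and> ipath (isub K p) q"
proof (induction p arbitrary: K)
  case (Cons j p)
  then show ?case by (cases K) simp_all
qed simp

lemma ipath_snoc: "ipath K (p @ [j]) \<longleftrightarrow> ipath K p \<and> j \<le> iord (isub K p)"
  by (simp add: ipath_append split: iobj.split)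

lemma isub_snoc_INode: "isub K p = INode a L \<Longrightarrow> isub K (p @ [j]) = L j"
  by (simp add: isub_append)

lemma isub_in: "K \<in> iobjs \<Longrightarrow> ipath K p \<Longrightarrow> isub K p \<in> iobjs"
proof (induction p arbitrary: K)
  case (Cons j p)
  then show ?case
    by (cases K) (auto dest: iobjs_nodeD(3))
qed simp

lemma iord_eq_0_iff: "K \<in> iobjs \<Longrightarrow> iord K = 0 \<longleftrightarrow> K = ITriv"
  by (cases K) (auto dest: iobjs_nodeD(1))

text \<open>
  For a trivial object both sides hold, since its only index \<open>0\<close> is an endpoint.
\<close>

lemma wedge_endpoint_iff_isub:
  assumes "K \<in> iobjs" and "ipath K (p @ [j])"
  shows "wedge_endpoint (iord (isub K p)) j \<longleftrightarrow> iord (isub K (p @ [j])) = 0"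
proof (cases "isub K p")
  case ITriv
  then show ?thesis
    using assms by (simp add: isub_append ipath_snoc wedge_endpoint_def)
next
  case (INode a L)
  have "INode a L \<in> iobjs" and "j \<le> a"
    using isub_in[OF assms(1), of p] assms(2) INode by (simp_all add: ipath_snoc)
  then show ?thesis
    using isub_in[OF assms] INode iobjs_nodeD(4)[of a L j]
    by (simp add: isub_snoc_INode iord_eq_0_iff)
qed

lemma isub_above_height:
  "of_height n K \<Longrightarrow> ipath K p \<Longrightarrow> n \<le> length p \<Longrightarrow> isub K p = ITriv"
proof (induction p arbitrary: n K)
  case Nil
  then show ?case by (auto elim: of_height.cases)
next
  case (Cons j p)
  show ?case
  proof (cases K)
    case (INode a L)
    then obtain m where "m < n" "of_height m (L j)"
      using Cons.prems of_height_nodeD(3)[of n a L j] by auto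
    then show ?thesis
      using Cons.IH[of m "L j"] Cons.prems INode by simp
  qed simp
qed

context
  fixes e :: "nat list \<Rightarrow> 'a"
  assumes e: "inj e"
begin

lemma path_tree_nodes: "e p \<in> nodes (path_tree e K) n \<longleftrightarrow> ipath K p \<and> length p = n"
  using e by (auto simp: path_tree_def dest: injD)

lemma path_tree_nodesE:
  assumes "x \<in> nodes (path_tree e K) n"
  obtains p where "x = e p" and "ipath K p" and "length p = n"
  using assms by (auto simp: path_tree_def)

lemma path_tree_simps:
  "ipath K (p @ [j]) \<Longrightarrow> length p = n \<Longrightarrow> par (path_tree e K) n (e (p @ [j])) = e p"
  "ipath K p \<Longrightarrow> length p = n \<Longrightarrow> ford (path_tree e K) n (e p) = iord (isub K p)"
  "ipath K (p @ [j]) \<Longrightarrow> length p = n \<Longrightarrow> lab (path_tree e K) n (e (p @ [j])) = j"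
  by (simp_all add: path_tree_def e)

lemma path_tree_nodes_SucE:
  assumes "x \<in> nodes (path_tree e K) (Suc n)"
  obtains p j where "x = e (p @ [j])" and "ipath K (p @ [j])" and "length p = n"
  using path_tree_nodesE[OF assms] by (metis length_Suc_conv_rev)

lemma path_tree_nodes_0: "nodes (path_tree e K) 0 = {e []}"
  by (auto simp: path_tree_def)

lemma root_path_tree: "root (path_tree e K) = e []"
  by (simp add: root_def path_tree_nodes_0)

lemma is_tree_path_tree: "is_tree (path_tree e K)"
  unfolding is_tree_def
proof (intro conjI allI PiE_I)
  fix n x assume "x \<in> nodes (path_tree e K) (Suc n)"
  then show "par (path_tree e K) n x \<in> nodes (path_tree e K) n"
    by (elim path_tree_nodes_SucE) (simp add: path_tree_simps path_tree_nodes ipath_snoc)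
next
  fix n x assume "x \<notin> nodes (path_tree e K) (Suc n)"
  then show "par (path_tree e K) n x = undefined"
    by (simp add: path_tree_def)
qed (simp add: path_tree_nodes_0)

lemma par_comp_path_tree:
  "ipath K (p @ q) \<Longrightarrow> length p = n \<Longrightarrow> length q = m \<Longrightarrow>
   par_comp (path_tree e K) n m (e (p @ q)) = e p"
proof (induction m arbitrary: q)
  case (Suc m)
  then obtain r j where q: "q = r @ [j]" "length r = m"
    by (metis length_Suc_conv_rev)
  have path: "ipath K ((p @ r) @ [j])"
    using Suc.prems(1) q by simp
  then have "par (path_tree e K) (n + m) (e ((p @ r) @ [j])) = e (p @ r)"
    using Suc.prems q by (intro path_tree_simps) simp_all
  moreover have "par_comp (path_tree e K) n m (e (p @ r)) = e p"
    using path Suc.prems q by (intro Suc.IH) (simp_all add: ipath_append)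
  ultimately show ?case
    using q by simp
qed simp

lemma ipath_replicate_ITriv: "ipath ITriv q \<longleftrightarrow> q = replicate (length q) 0"
  by (induction q) auto

text \<open>
  A path of length \<open>n\<close> in an object of height \<open>n\<close> ends in the trivial object, so it can be prolonged
  by zeros only.
\<close>

lemma has_degree_path_tree:
  assumes "of_height n K"
  shows "has_degree (path_tree e K) n"
  unfolding has_degree_def
proof (intro allI impI)
  fix m :: nat
  \<comment> \<open>above level \<open>n\<close>, a path is determined by its first \<open>n\<close> indices\<close>
  have split: "\<exists>p. x = e (p @ replicate m 0) \<and> ipath K (p @ replicate m 0) \<and> length p = n"
    if x: "x \<in> nodes (path_tree e K) (n + m)" for x
  proof -
    obtain r where r: "x = e r" "ipath K r" "length r = n + m"
      by (rule path_tree_nodesE[OF x])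
    have "ipath K (take n r @ drop n r)"
      using r by simp
    then have "ipath (isub K (take n r)) (drop n r)" and "ipath K (take n r)"
      unfolding ipath_append by blast+
    then have "drop n r = replicate m 0"
      using isub_above_height[OF assms, of "take n r"] r ipath_replicate_ITriv[of "drop n r"]
      by simp
    then show ?thesis
      using r by (metis append_take_drop_id le_add1 length_take min_absorb2)
  qed
  have path: "ipath K (p @ replicate m 0)" if "ipath K p" "length p = n" for p
    using that isub_above_height[OF assms, of p] ipath_replicate_ITriv[of "replicate m 0"]
    by (simp add: ipath_append)
  show "bij_betw (par_comp (path_tree e K) n m)
      (nodes (path_tree e K) (n + m)) (nodes (path_tree e K) n)"
  proof (rule bij_betw_byWitness[where f' = "\<lambda>y. e (inv e y @ replicate m 0)"])
    show "\<forall>x \<in> nodes (path_tree e K) (n + m).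
        e (inv e (par_comp (path_tree e K) n m x) @ replicate m 0) = x"
      using split by (fastforce simp: par_comp_path_tree e)
    show "\<forall>y \<in> nodes (path_tree e K) n.
        par_comp (path_tree e K) n m (e (inv e y @ replicate m 0)) = y"
      by (auto elim!: path_tree_nodesE simp: par_comp_path_tree path e)
    show "par_comp (path_tree e K) n m ` nodes (path_tree e K) (n + m) \<subseteq> nodes (path_tree e K) n"
      using split by (fastforce simp: par_comp_path_tree path_tree_nodes ipath_append)
    show "(\<lambda>y. e (inv e y @ replicate m 0)) ` nodes (path_tree e K) n
        \<subseteq> nodes (path_tree e K) (n + m)"
      by (auto elim!: path_tree_nodesE simp: path_tree_nodes path e)
  qed
qed

lemma path_tree_in:
  assumes "K \<in> iobjs"
  shows "path_tree e K \<in> tobjs"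
proof -
  let ?T = "path_tree e K"
  have "\<exists>n. has_degree ?T n"
    using assms has_degree_path_tree unfolding iobjs_def by blast
  moreover have "ford ?T n \<in> extensional (nodes ?T n)"
    "lab ?T n \<in> extensional (nodes ?T (Suc n))" for n
    by (simp_all add: path_tree_def)
  moreover have "bij_betw (\<lambda>x. (par ?T n x, lab ?T n x))
      (nodes ?T (Suc n)) (SIGMA y : nodes ?T n. {..ford ?T n y})" for n
  proof (rule bij_betw_byWitness[where f' = "\<lambda>(y, j). e (inv e y @ [j])"])
    show "\<forall>x \<in> nodes ?T (Suc n). (\<lambda>(y, j). e (inv e y @ [j])) (par ?T n x, lab ?T n x) = x"
      by (auto elim!: path_tree_nodes_SucE simp: path_tree_simps e)
    show "\<forall>z \<in> SIGMA y : nodes ?T n. {..ford ?T n y}.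
        (par ?T n ((\<lambda>(y, j). e (inv e y @ [j])) z), lab ?T n ((\<lambda>(y, j). e (inv e y @ [j])) z)) = z"
      by (auto elim!: path_tree_nodesE simp: path_tree_simps ipath_snoc e)
    show "(\<lambda>x. (par ?T n x, lab ?T n x)) ` nodes ?T (Suc n)
        \<subseteq> (SIGMA y : nodes ?T n. {..ford ?T n y})"
      by (auto elim!: path_tree_nodes_SucE simp: path_tree_simps path_tree_nodes ipath_snoc)
    show "(\<lambda>(y, j). e (inv e y @ [j])) ` (SIGMA y : nodes ?T n. {..ford ?T n y})
        \<subseteq> nodes ?T (Suc n)"
      by (auto elim!: path_tree_nodesE simp: path_tree_simps path_tree_nodes ipath_snoc e)
  qed
  moreover have "cropped ?T"
    unfolding cropped_def
  proof (intro allI ballI)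
    fix n x assume "x \<in> nodes ?T (Suc n)"
    then obtain p j where x: "x = e (p @ [j])" "ipath K (p @ [j])" "length p = n"
      by (rule path_tree_nodes_SucE)
    then show "wedge_endpoint (ford ?T n (par ?T n x)) (lab ?T n x) \<longleftrightarrow> ford ?T (Suc n) x = 0"
      using wedge_endpoint_iff_isub[OF assms x(2)]
      by (simp add: path_tree_simps ipath_snoc)
  qed
  ultimately show ?thesis
    using is_tree_path_tree unfolding tobjs_def by blast
qed

lemma restr_nodes_path_tree:
  assumes "j \<le> a"
  shows "restr_nodes (path_tree e (INode a L)) (e [j]) m = nodes (path_tree (e \<circ> Cons j) (L j)) m"
    (is "?L = ?R")
proof -
  have par: "par_comp (path_tree e (INode a L)) 1 m (e (i # p)) = e [i]"
    if "i \<le> a" "ipath (L i) p" "length p = m" for i p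
    using par_comp_path_tree[of "INode a L" "[i]" p 1 m] that by simp
  show ?thesis
  proof
    show "?L \<subseteq> ?R"
    proof
      fix x assume x: "x \<in> ?L"
      then have "x \<in> nodes (path_tree e (INode a L)) (Suc m)"
        by (rule restr_nodes_sub)
      then obtain r where r: "x = e r" "ipath (INode a L) r" "length r = Suc m"
        by (rule path_tree_nodesE)
      then obtain i p where r_eq: "r = i # p"
        by (cases r) simp_all
      have "e [i] = e [j]"
        using x r r_eq par[of i p] by (simp add: restr_nodes_def)
      then show "x \<in> ?R"
        using r r_eq injD[OF e] by (auto simp: path_tree_def)
    qed
    show "?R \<subseteq> ?L"
    proof
      fix x assume "x \<in> ?R"
      then obtain p where p: "x = e (j # p)" "ipath (L j) p" "length p = m"
        by (auto simp: path_tree_def)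
      moreover from this have "e (j # p) \<in> nodes (path_tree e (INode a L)) (Suc m)"
        unfolding path_tree_nodes using assms by simp
      ultimately show "x \<in> ?L"
        using par[OF assms] by (simp add: restr_nodes_def)
    qed
  qed
qed

lemma t_restr_path_tree:
  assumes "j \<le> a"
  shows "t_restr (path_tree e (INode a L)) (e [j]) = path_tree (e \<circ> Cons j) (L j)"
    (is "t_restr ?T ?x = ?S")
proof -
  have e': "inj (e \<circ> Cons j)"
    using e by (simp add: inj_compose)
  have "restrict (par ?T (Suc m)) (nodes ?S (Suc m)) = par ?S m" for m
    using assms by (auto simp: path_tree_def fun_eq_iff inv_f_f[OF e] inv_f_f[OF e', simplified])
  moreover have "restrict (ford ?T (Suc m)) (nodes ?S m) = ford ?S m" for m
    using assms by (auto simp: path_tree_def fun_eq_iff inv_f_f[OF e] inv_f_f[OF e', simplified])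
  moreover have "restrict (lab ?T (Suc m)) (nodes ?S (Suc m)) = lab ?S m" for m
    using assms by (auto simp: path_tree_def fun_eq_iff inv_f_f[OF e] inv_f_f[OF e', simplified])
  ultimately show ?thesis
    by (simp add: t_restr_def restr_nodes_path_tree[OF assms] fun_eq_iff)
qed

end

text \<open>
  By induction on \<open>K\<close> for all encodings \<open>e\<close> at once, as the encoding changes in the restrictions.
\<close>

lemma Xi_ob_path_tree: "inj e \<Longrightarrow> K \<in> iobjs \<Longrightarrow> Xi_ob (path_tree e K) = K"
proof (induction K arbitrary: e)
  case ITriv
  have "path_tree e ITriv \<in> tobjs"
    by (rule path_tree_in) fact+
  moreover from this have "t_trivial (path_tree e ITriv)"
    using path_tree_simps(2)[OF ITriv.prems(1), of ITriv "[]" 0]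
    by (simp add: trivial_iff root_path_tree ITriv.prems(1))
  ultimately show ?case
    by (rule Xi_ob_trivial)
next
  case (INode a L)
  let ?T = "path_tree e (INode a L)"
  note e = INode.prems(1)
  have T: "?T \<in> tobjs"
    by (rule path_tree_in) fact+
  have a: "ford ?T 0 (root ?T) = a"
    using path_tree_simps(2)[OF e, of "INode a L" "[]" 0] by (simp add: root_path_tree e)
  then have T': "\<not> t_trivial ?T"
    using trivial_iff[OF T] iobjs_nodeD(1)[OF INode.prems(2)] by simp
  have "Xi_ob (t_restr ?T (child ?T j)) = L j" if j: "j \<le> a" for j
  proof -
    have "e ([] @ [j]) \<in> nodes ?T (Suc 0)" and "lab ?T 0 (e ([] @ [j])) = j"
      unfolding path_tree_nodes[OF e] using j
      by (simp, intro path_tree_simps(3)[OF e]) simp_all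
    then have "child ?T j = e [j]"
      using child_lab[OF T, of "e [j]"] by simp
    then have "t_restr ?T (child ?T j) = path_tree (e \<circ> Cons j) (L j)"
      by (simp add: t_restr_path_tree[OF e j])
    moreover have "Xi_ob (path_tree (e \<circ> Cons j) (L j)) = L j"
      using e iobjs_nodeD(3)[OF INode.prems(2) j]
      by (intro INode.IH) (auto simp: inj_def)
    ultimately show ?thesis by simp
  qed
  then show ?case
    using iobjs_nodeD(2)[OF INode.prems(2)]
    by (simp add: Xi_ob_node[OF T T'] a extensional_restrict cong: restrict_cong)
qed

theorem proposition8p6:
  assumes "infinite (UNIV :: 'a set)"
  shows "is_equivalence (tDelta :: ('a tobj, 'a tmor) cat) iDelta Xi_Delta
    \<and> FOb (Xi_Delta :: ('a tobj, 'a tmor, iobj, imor) fctr) ` Obj tDelta = Obj iDelta"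
proof -
  obtain c :: "nat \<Rightarrow> 'a" where "inj c"
    using infinite_countable_subset[OF assms] by blast
  then have e: "inj (c \<circ> (to_nat :: nat list \<Rightarrow> nat))"
    by (simp add: inj_compose)
  have surj: "FOb (Xi_Delta :: ('a tobj, 'a tmor, iobj, imor) fctr) ` Obj tDelta = Obj iDelta"
  proof
    show "FOb (Xi_Delta :: ('a tobj, 'a tmor, iobj, imor) fctr) ` Obj tDelta \<subseteq> Obj iDelta"
      by (auto simp: Xi_Delta_def tDelta_def iDelta_def Xi_ob_in)
    show "Obj iDelta \<subseteq> FOb (Xi_Delta :: ('a tobj, 'a tmor, iobj, imor) fctr) ` Obj tDelta"
      using path_tree_in[OF e] Xi_ob_path_tree[OF e]
      by (force simp: Xi_Delta_def tDelta_def iDelta_def image_iff)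
  qed
  have "bij_betw (FHom Xi_Delta B A) (Hom tDelta B A)
      (Hom iDelta (FOb Xi_Delta B) (FOb Xi_Delta A))"
    if "B \<in> Obj tDelta" "A \<in> Obj tDelta" for A B :: "'a tobj"
    using Xi_fully_faithful that by (simp add: Xi_Delta_def tDelta_def iDelta_def)
  then show ?thesis
    using equivalence_if_fully_faithful_surj[OF is_category_tDelta is_category_iDelta is_functor_Xi]
      surj by blast
qed

end
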